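(* Let $0<\epsilon\le 1.04$. Then for all $\theta\in\mathbb{R}$ and all $Q\in\mathcal{Q}_\epsilon$, $$I_\theta(Q\mathcal{P}) \;\le\; I_\theta\big(Q^{\mathrm{sgn}}_{\theta,\epsilon}\mathcal{P}\big) \;=\; \frac{2}{\pi}\,\frac{(e^\epsilon-1)^2}{(e^\epsilon+1)^2}.$$ (In the middle term, the mechanism $Q^{\mathrm{sgn}}_{\theta,\epsilon}$ is held fixed and the Fisher information of the resulting model is evaluated at the parameter value $\theta$.) In particular, for every $\theta\in\mathbb{R}$, the sign mechanism $Q^{\mathrm{sgn}}_{\theta,\epsilon}\in\mathcal{Q}_\epsilon$ solves the optimization problem $\max_Q I_\theta(Q\mathcal{P})$ subject to $Q\in\mathcal{Q}_\epsilon$.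
   Context: Model: $P_\theta=N(\theta,1)$ for $\theta\in\mathbb{R}$, with Lebesgue density $p_\theta$, and $\mathcal{P}=\{P_\theta:\theta\in\mathbb{R}\}$. Privacy mechanisms: for $\epsilon>0$, $\mathcal{Q}_\epsilon$ is the class of all $\epsilon$-locally differentially private mechanisms with inputs in $\mathbb{R}$, i.e. all Markov kernels $Q$ from $\mathbb{R}$ to an arbitrary measurable space $(\mathcal{Z},\mathcal{G})$ (the output space may depend on $Q$) such that $Q(A|x)\le e^\epsilon Q(A|x')$ for all $x,x'\in\mathbb{R}$ and all $A\in\mathcal{G}$. Privatized model: $QP_\theta(A)=\int_{\mathbb{R}}Q(A|x)\,P_\theta(dx)$ is the law of the sanitized observation $Z$, and $Q\mathcal{P}=\{QP_\theta:\theta\in\mathbb{R}\}$. Fisher information: $I_\theta(Q\mathcal{P})=\mathbb{E}_{Z\sim QP_\theta}\big[\big(\tfrac{\partial}{\partial\theta}\log QP_\theta(Z)\big)^2\big]$, where $QP_\theta(z)$ denotes a density of $QP_\theta$ with respect to a dominating measure. Concretely: fix $x_0\in\mathbb{R}$ and let $\nu(dz)=Q(dz|x_0)$; let $q:\mathcal{Z}\times\mathbb{R}\to[e^{-\epsilon},e^{\epsilon}]$ be a measurable function such that $q(z|x)p_\theta(x)$ is a density of $Q(dz|x)P_\theta(dx)$ with respect to $\nu\otimes\text{Lebesgue}$; put $q_\theta(z)=\int_{\mathbb{R}}q(z|x)p_\theta(x)\,dx$ and $t_\theta(z)=\int_{\mathbb{R}}(x-\theta)\frac{q(z|x)p_\theta(x)}{q_\theta(z)}\,dx$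 (the score of $Q\mathcal{P}$ at $\theta$). Then $I_\theta(Q\mathcal{P})=\int_{\mathcal{Z}}t_\theta(z)^2q_\theta(z)\,\nu(dz)$, which is well defined and finite. Sign mechanism: with $\operatorname{sgn}(0):=1$ and $p_\epsilon:=\frac{e^\epsilon}{1+e^\epsilon}$, $Q^{\mathrm{sgn}}_{\theta,\epsilon}$ has output space $\{-1,1\}$ and, for $z\in\{-1,1\}$ and $x\in\mathbb{R}$, $Q^{\mathrm{sgn}}_{\theta,\epsilon}(\{z\}|x)=p_\epsilon$ if $z=\operatorname{sgn}(x-\theta)$ and $Q^{\mathrm{sgn}}_{\theta,\epsilon}(\{z\}|x)=1-p_\epsilon$ otherwise. *)

theory Defs
  imports "HOL-Probability.Probability"
begin

definition gaussian_law :: "real \<Rightarrow> real measure" where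
  "gaussian_law \<theta> = density lborel (\<lambda>x. ennreal (normal_density \<theta> 1 x))"

text \<open>Markov kernels from the real line to a measurable space \<open>Z\<close>; only \<open>space Z\<close> and
  \<open>sets Z\<close> matter, the measure carried by \<open>Z\<close> is irrelevant.\<close>

definition ldp_mechanisms :: "real \<Rightarrow> 'z measure \<Rightarrow> (real \<Rightarrow> 'z measure) set" where
  "ldp_mechanisms \<epsilon> Z = {Q \<in> borel \<rightarrow>\<^sub>M prob_algebra Z.
     \<forall>x x'. \<forall>A\<in>sets Z. measure (Q x) A \<le> exp \<epsilon> * measure (Q x') A}"

text \<open>The measure \<open>Q(dz|x) P\<^sub>\<theta>(dx)\<close> on \<open>Z \<times> \<real>\<close>.\<close>

definition joint_law :: "'z measure \<Rightarrow> (real \<Rightarrow> 'z measure) \<Rightarrow> real \<Rightarrow> ('z \<times> real) measure" where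
  "joint_law Z Q \<theta> =
     gaussian_law \<theta> \<bind> (\<lambda>x. distr (Q x) (Z \<Otimes>\<^sub>M borel) (\<lambda>z. (z, x)))"

definition kernel_density ::
    "'z measure \<Rightarrow> (real \<Rightarrow> 'z measure) \<Rightarrow> real \<Rightarrow> ('z \<Rightarrow> real \<Rightarrow> real) \<Rightarrow> bool" where
  "kernel_density Z Q x0 q \<longleftrightarrow>
     (\<lambda>(z, x). q z x) \<in> borel_measurable (Z \<Otimes>\<^sub>M borel) \<and>
     (\<exists>\<epsilon>>0. \<forall>z\<in>space Z. \<forall>x. q z x \<in> {exp (-\<epsilon>)..exp \<epsilon>}) \<and>
     (\<forall>\<theta>. joint_law Z Q \<theta> =
        density (Q x0 \<Otimes>\<^sub>M lborel) (\<lambda>(z, x). ennreal (q z x * normal_density \<theta> 1 x)))"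

text \<open>A version \<open>q\<close> of the kernel density fixes densities of all privatized laws at once: by
  \<open>privatized_law\<close> below, \<open>privatized_density q \<theta>\<close> is a density of the law of the sanitized
  observation with respect to \<open>Q x0\<close>, and by \<open>score_eq_log_derivative\<close> the function
  \<open>score q \<theta>\<close> is the derivative of its logarithm in \<open>\<theta>\<close>.\<close>

definition privatized_density :: "('z \<Rightarrow> real \<Rightarrow> real) \<Rightarrow> real \<Rightarrow> 'z \<Rightarrow> real" where
  "privatized_density q \<theta> z = (\<integral>x. q z x * normal_density \<theta> 1 x \<partial>lborel)"

definition score :: "('z \<Rightarrow> real \<Rightarrow> real) \<Rightarrow> real \<Rightarrow> 'z \<Rightarrow> real" where
  "score q \<theta> z =
     (\<integral>x. (x - \<theta>) * (q z x * normal_density \<theta> 1 x / privatized_density q \<theta> z) \<partial>lborel)"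

text \<open>For a locally differentially private \<open>Q\<close> the value exists and does not depend on the reference point \<open>x0\<close> and on the version \<open>q\<close> of the
  kernel density; see \<open>fisher_information_eq\<close> and \<open>kernel_density_exists\<close> below.\<close>

definition fisher_information :: "'z measure \<Rightarrow> (real \<Rightarrow> 'z measure) \<Rightarrow> real \<Rightarrow> real" where
  "fisher_information Z Q \<theta> =
     (THE I. \<exists>x0 q. kernel_density Z Q x0 q \<and>
        I = (\<integral>z. (score q \<theta> z)\<^sup>2 * privatized_density q \<theta> z \<partial>(Q x0)))"

definition sign1 :: "real \<Rightarrow> int" where
  "sign1 y = (if y \<ge> 0 then 1 else -1)"

definition sign_space :: "int measure" where
  "sign_space = count_space {-1, 1}"

definition sign_mechanism :: "real \<Rightarrow> real \<Rightarrow> real \<Rightarrow> int measure" where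
  "sign_mechanism \<theta> \<epsilon> x = point_measure {-1, 1}
     (\<lambda>z. ennreal (if z = sign1 (x - \<theta>) then exp \<epsilon> / (1 + exp \<epsilon>)
                   else 1 - exp \<epsilon> / (1 + exp \<epsilon>)))"

lemma kernel_facts:
  assumes Q: "Q \<in> borel \<rightarrow>\<^sub>M prob_algebra Z"
  shows "Q \<in> borel \<rightarrow>\<^sub>M subprob_algebra Z" "sets (Q x) = sets Z" "space (Q x) = space Z"
    "prob_space (Q x)"
proof -
  show 1: "Q \<in> borel \<rightarrow>\<^sub>M subprob_algebra Z" by (rule measurable_prob_algebraD[OF Q])
  show 2: "sets (Q x) = sets Z" using subprob_measurableD(2)[OF 1] by simp
  then show "space (Q x) = space Z" by (rule sets_eq_imp_space_eq)
  show "prob_space (Q x)"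
    using measurable_space[OF Q] by (simp add: space_prob_algebra)
qed

lemma prob_space_gaussian_law: "prob_space (gaussian_law \<theta>)"
  unfolding gaussian_law_def by (rule prob_space_normal_density) simp

lemma sets_gaussian_law: "sets (gaussian_law \<theta>) = sets borel"
  by (simp add: gaussian_law_def)

lemma nn_integral_joint_law:
  assumes Q: "Q \<in> borel \<rightarrow>\<^sub>M prob_algebra Z"
    and F[measurable]: "F \<in> borel_measurable (Z \<Otimes>\<^sub>M borel)"
  shows "(\<integral>\<^sup>+w. F w \<partial>joint_law Z Q \<theta>) = (\<integral>\<^sup>+x. \<integral>\<^sup>+z. F (z, x) \<partial>Q x \<partial>gaussian_law \<theta>)"
proof -
  note Q'[measurable] = kernel_facts(1)[OF Q]
  note sQ = kernel_facts(2)[OF Q]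
  have K: "(\<lambda>x. distr (Q x) (Z \<Otimes>\<^sub>M borel) (\<lambda>z. (z, x))) \<in> gaussian_law \<theta> \<rightarrow>\<^sub>M subprob_algebra (Z \<Otimes>\<^sub>M borel)"
    unfolding gaussian_law_def
    by (simp, rule measurable_distr2[OF _ Q'], simp, measurable)
  have "(\<integral>\<^sup>+w. F w \<partial>joint_law Z Q \<theta>) =
     (\<integral>\<^sup>+x. \<integral>\<^sup>+w. F w \<partial>distr (Q x) (Z \<Otimes>\<^sub>M borel) (\<lambda>z. (z, x)) \<partial>gaussian_law \<theta>)"
    unfolding joint_law_def by (rule nn_integral_bind[OF F K])
  also have "\<dots> = (\<integral>\<^sup>+x. \<integral>\<^sup>+z. F (z, x) \<partial>Q x \<partial>gaussian_law \<theta>)"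
  proof (rule nn_integral_cong)
    fix x :: real
    have "(\<lambda>z. (z, x)) \<in> Q x \<rightarrow>\<^sub>M Z \<Otimes>\<^sub>M borel"
      unfolding measurable_cong_sets[OF sQ refl] by measurable
    then show "(\<integral>\<^sup>+w. F w \<partial>distr (Q x) (Z \<Otimes>\<^sub>M borel) (\<lambda>z. (z, x)))
       = (\<integral>\<^sup>+z. F (z, x) \<partial>Q x)"
      by (subst nn_integral_distr) auto
  qed
  finally show ?thesis .
qed

lemma sets_joint_law:
  assumes Q: "Q \<in> borel \<rightarrow>\<^sub>M prob_algebra Z"
  shows "sets (joint_law Z Q \<theta>) = sets (Z \<Otimes>\<^sub>M borel)"
  unfolding joint_law_def by (rule sets_bind) (auto simp: gaussian_law_def)

lemma emeasure_joint_law: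
  assumes Q: "Q \<in> borel \<rightarrow>\<^sub>M prob_algebra Z" and C[measurable]: "C \<in> sets (Z \<Otimes>\<^sub>M borel)"
  shows "emeasure (joint_law Z Q \<theta>) C =
    (\<integral>\<^sup>+x. emeasure (Q x) ((\<lambda>z. (z, x)) -` C) \<partial>gaussian_law \<theta>)"
proof -
  have S: "(\<lambda>z. (z, x)) -` C \<in> sets (Q x)" for x
    unfolding kernel_facts(2)[OF Q] by (rule sets_Pair2[OF C])
  have "emeasure (joint_law Z Q \<theta>) C = (\<integral>\<^sup>+w. indicator C w \<partial>joint_law Z Q \<theta>)"
    using C by (simp add: sets_joint_law[OF Q])
  also have "\<dots> = (\<integral>\<^sup>+x. \<integral>\<^sup>+z. indicator C (z, x) \<partial>Q x \<partial>gaussian_law \<theta>)"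
    by (rule nn_integral_joint_law[OF Q]) simp
  also have "\<dots> = (\<integral>\<^sup>+x. emeasure (Q x) ((\<lambda>z. (z, x)) -` C) \<partial>gaussian_law \<theta>)"
  proof (rule nn_integral_cong)
    fix x
    have "(\<integral>\<^sup>+z. indicator C (z, x) \<partial>Q x) = (\<integral>\<^sup>+z. indicator ((\<lambda>z. (z, x)) -` C) z \<partial>Q x)"
      by (intro nn_integral_cong) (simp add: indicator_def)
    then show "(\<integral>\<^sup>+z. indicator C (z, x) \<partial>Q x) = emeasure (Q x) ((\<lambda>z. (z, x)) -` C)"
      using S by simp
  qed
  finally show ?thesis .
qed

lemma density_le_AE:
  fixes f g :: "'a \<Rightarrow> ennreal"
  assumes f[measurable]: "f \<in> borel_measurable K" and g[measurable]: "g \<in> borel_measurable K"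
    and fin: "(\<integral>\<^sup>+w. f w \<partial>K) < \<top>"
    and le: "\<And>C. C \<in> sets K \<Longrightarrow> emeasure (density K f) C \<le> emeasure (density K g) C"
  shows "AE w in K. f w \<le> g w"
proof -
  let ?C = "{w\<in>space K. g w < f w}"
  have C[measurable]: "?C \<in> sets K" by measurable
  have f1: "(\<integral>\<^sup>+w. f w * indicator ?C w \<partial>K) < \<top>"
    by (rule le_less_trans[OF _ fin]) (auto intro!: nn_integral_mono split: split_indicator)
  have g1: "(\<integral>\<^sup>+w. g w * indicator ?C w \<partial>K) < \<top>"
    by (rule le_less_trans[OF _ f1]) (auto intro!: nn_integral_mono split: split_indicator)
  have "(\<integral>\<^sup>+w. (f w - g w) * indicator ?C w \<partial>K) = (\<integral>\<^sup>+w. f w * indicator ?C w - g w * indicator ?C w \<partial>K)"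
    by (intro nn_integral_cong) (auto split: split_indicator)
  also have "\<dots> = (\<integral>\<^sup>+w. f w * indicator ?C w \<partial>K) - (\<integral>\<^sup>+w. g w * indicator ?C w \<partial>K)"
    using g1 by (intro nn_integral_diff) (auto split: split_indicator)
  also have "\<dots> = 0"
    using le[OF C] f1 by (auto simp: emeasure_density intro!: diff_eq_0_ennreal)
  finally have "AE w in K. (f w - g w) * indicator ?C w = 0"
    by (subst (asm) nn_integral_0_iff_AE) auto
  then show ?thesis
  proof (rule AE_mp, intro AE_I2 impI)
    fix w assume "w \<in> space K" "(f w - g w) * indicator ?C w = 0"
    then show "f w \<le> g w"
      by (cases "g w < f w") (auto simp: diff_eq_0_iff_ennreal)
  qed
qed

lemma kernel_density_exists:
  fixes Z :: "'z measure"
  assumes Q: "Q \<in> ldp_mechanisms \<epsilon> Z" and \<epsilon>: "\<epsilon> > 0"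
  shows "\<exists>q. kernel_density Z Q x0 q"
proof -
  have Qm: "Q \<in> borel \<rightarrow>\<^sub>M prob_algebra Z"
    and ldp: "\<And>x x' A. A \<in> sets Z \<Longrightarrow> measure (Q x) A \<le> exp \<epsilon> * measure (Q x') A"
    using Q by (auto simp: ldp_mechanisms_def)
  have sQ[measurable_cong]: "sets (Q x) = sets Z" for x by (rule kernel_facts(2)[OF Qm])
  have spQ: "space (Q x) = space Z" for x by (rule kernel_facts(3)[OF Qm])
  interpret Qp: prob_space "Q x" for x by (rule kernel_facts(4)[OF Qm])
  interpret G: prob_space "gaussian_law \<theta>" for \<theta> by (rule prob_space_gaussian_law)
  interpret K: pair_prob_space "Q x0" "gaussian_law 0" ..
  have sG[measurable_cong]: "sets (gaussian_law \<theta>) = sets borel" for \<theta> by (rule sets_gaussian_law)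
  define K where "K = Q x0 \<Otimes>\<^sub>M gaussian_law 0"
  define J where "J = joint_law Z Q 0"
  have sK[measurable_cong]: "sets K = sets (Z \<Otimes>\<^sub>M borel)"
    unfolding K_def by (intro sets_pair_measure_cong sQ sG)
  have sJ: "sets J = sets K"
    unfolding J_def sK by (rule sets_joint_law[OF Qm])
  have ldp': "emeasure (Q x) A \<le> ennreal (exp \<epsilon>) * emeasure (Q x') A" if "A \<in> sets Z" for x x' A
    using ldp[OF that, of x x'] by (simp add: Qp.emeasure_eq_measure ennreal_mult[symmetric])
  have KC: "emeasure K C = (\<integral>\<^sup>+x. emeasure (Q x0) ((\<lambda>z. (z, x)) -` C) \<partial>gaussian_law 0)"
    if "C \<in> sets K" for C
    using that unfolding K_def by (rule K.emeasure_pair_measure_alt2)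
  have JC: "emeasure J C = (\<integral>\<^sup>+x. emeasure (Q x) ((\<lambda>z. (z, x)) -` C) \<partial>gaussian_law 0)"
    if "C \<in> sets K" for C
    using that unfolding J_def sK by (rule emeasure_joint_law[OF Qm])
  have sec: "(\<lambda>z. (z, x)) -` C \<in> sets Z" if "C \<in> sets K" for C x
    using that unfolding sK by (rule sets_Pair2)
  have msec: "(\<lambda>x. emeasure (Q x0) ((\<lambda>z. (z, x)) -` C)) \<in> borel_measurable (gaussian_law 0)"
    if "C \<in> sets K" for C
    using that unfolding K_def by (rule K.measurable_emeasure_Pair2)
  have msec': "(\<lambda>x. emeasure (Q x) ((\<lambda>z. (z, x)) -` C)) \<in> borel_measurable (gaussian_law 0)"
    if "C \<in> sets K" for C
  proof -
    have [measurable]: "C \<in> sets (Z \<Otimes>\<^sub>M borel)" using that by (simp add: sK)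
    have "(\<lambda>(x, z). indicator C (z, x) :: ennreal) \<in> borel_measurable (borel \<Otimes>\<^sub>M Z)"
      by measurable
    then have "(\<lambda>x. \<integral>\<^sup>+z. indicator C (z, x) \<partial>Q x) \<in> borel_measurable borel"
      using kernel_facts(1)[OF Qm] by (rule nn_integral_measurable_subprob_algebra2)
    moreover have "(\<integral>\<^sup>+z. indicator C (z, x) \<partial>Q x) = emeasure (Q x) ((\<lambda>z. (z, x)) -` C)" for x
    proof -
      have "(\<integral>\<^sup>+z. indicator C (z, x) \<partial>Q x) = (\<integral>\<^sup>+z. indicator ((\<lambda>z. (z, x)) -` C) z \<partial>Q x)"
        by (intro nn_integral_cong) (simp add: indicator_def)
      then show ?thesis using sec[OF that] by (simp add: sQ)
    qed
    ultimately show ?thesis by (simp cong: measurable_cong_sets add: measurable_cong_sets[OF sG refl])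
  qed
  have JK: "emeasure J C \<le> ennreal (exp \<epsilon>) * emeasure K C" if "C \<in> sets K" for C
    unfolding KC[OF that] JC[OF that]
    by (subst nn_integral_cmult[symmetric])
       (auto intro!: nn_integral_mono ldp' sec that msec)
  have KJ: "emeasure K C \<le> ennreal (exp \<epsilon>) * emeasure J C" if "C \<in> sets K" for C
    unfolding KC[OF that] JC[OF that]
    by (subst nn_integral_cmult[symmetric])
       (auto intro!: nn_integral_mono ldp' sec that msec')
  interpret Kp: prob_space K unfolding K_def by (rule prob_space_pair) unfold_locales
  have "absolutely_continuous K J"
    unfolding absolutely_continuous_def
  proof
    fix N assume N: "N \<in> null_sets K"
    then have "emeasure J N \<le> 0" using JK[of N] by (auto simp: null_sets_def)
    with N show "N \<in> null_sets J" by (auto simp: null_sets_def sJ)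
  qed
  from Kp.Radon_Nikodym[OF this sJ] obtain f where
    f[measurable]: "f \<in> borel_measurable K" and Jf: "density K f = J" by blast
  have "emeasure J (space K) \<le> ennreal (exp \<epsilon>) * 1"
    using JK[of "space K"] by (simp add: Kp.emeasure_space_1)
  then have "emeasure (density K f) (space K) < \<top>"
    unfolding Jf by (auto simp: top_unique less_top[symmetric])
  then have ffin: "(\<integral>\<^sup>+w. f w \<partial>K) < \<top>"
    by (subst (asm) emeasure_density) (auto cong: nn_integral_cong)
  have up: "AE w in K. f w \<le> ennreal (exp \<epsilon>)"
  proof (rule density_le_AE[OF f _ ffin])
    fix C assume C: "C \<in> sets K"
    then show "emeasure (density K f) C \<le> emeasure (density K (\<lambda>w. ennreal (exp \<epsilon>))) C"
      using JK[OF C] by (simp add: Jf emeasure_density nn_integral_cmult_indicator)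
  qed simp
  have lo: "AE w in K. 1 \<le> ennreal (exp \<epsilon>) * f w"
  proof (rule density_le_AE)
    fix C assume C[measurable]: "C \<in> sets K"
    have "emeasure (density K (\<lambda>w. ennreal (exp \<epsilon>) * f w)) C = ennreal (exp \<epsilon>) * emeasure (density K f) C"
      by (simp add: emeasure_density mult.assoc nn_integral_cmult)
    then show "emeasure (density K (\<lambda>w. 1)) C \<le> emeasure (density K (\<lambda>w. ennreal (exp \<epsilon>) * f w)) C"
      using KJ[OF C] by (simp add: Jf density_1)
  qed (simp_all add: Kp.emeasure_space_1)
  define q where "q z x = max (exp (-\<epsilon>)) (min (exp \<epsilon>) (enn2real (f (z, x))))" for z x
  have qm[measurable]: "(\<lambda>(z, x). q z x) \<in> borel_measurable (Z \<Otimes>\<^sub>M borel)"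
  proof -
    have [measurable]: "f \<in> borel_measurable (Z \<Otimes>\<^sub>M borel)"
      using f by (simp add: measurable_cong_sets[OF sK refl])
    have "(\<lambda>(z, x). q z x) = (\<lambda>w. max (exp (-\<epsilon>)) (min (exp \<epsilon>) (enn2real (f w))))"
      by (auto simp: q_def)
    then show ?thesis by simp
  qed
  have qb: "q z x \<in> {exp (-\<epsilon>)..exp \<epsilon>}" for z x
    using \<epsilon> by (auto simp: q_def)
  have fq: "AE w in K. f w = ennreal (case w of (z, x) \<Rightarrow> q z x)"
    using up lo
  proof eventually_elim
    case (elim w)
    obtain r where r: "f w = ennreal r" "r \<ge> 0"
      using elim(1) by (cases "f w") (auto simp: top_unique)
    have "r \<le> exp \<epsilon>" using elim(1) r by simp
    moreover have "1 \<le> exp \<epsilon> * r" using elim(2) r by (simp add: ennreal_mult[symmetric] del: ennreal_1 flip: ennreal_1)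
    then have "exp (-\<epsilon>) \<le> r" by (simp add: exp_minus field_simps)
    ultimately show ?case using r by (cases w) (simp add: q_def)
  qed
  have Kd: "K = density (Q x0 \<Otimes>\<^sub>M lborel) (\<lambda>(z, x). ennreal (normal_density 0 1 x))"
  proof -
    have "density (Q x0) (\<lambda>_. 1) \<Otimes>\<^sub>M density lborel (\<lambda>x. ennreal (normal_density 0 1 x))
       = density (Q x0 \<Otimes>\<^sub>M lborel) (\<lambda>(z, x). 1 * ennreal (normal_density 0 1 x))"
      using G.sigma_finite_measure_axioms[of 0]
      by (intro pair_measure_density) (auto simp: gaussian_law_def intro: lborel.sigma_finite_measure_axioms)
    then show ?thesis by (simp add: K_def gaussian_law_def density_1)
  qed
  have Jd: "J = density K (\<lambda>(z, x). ennreal (q z x))"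
    unfolding Jf[symmetric] using fq by (intro density_cong) (auto simp: case_prod_beta')
  have "joint_law Z Q \<theta> =
        density (Q x0 \<Otimes>\<^sub>M lborel) (\<lambda>(z, x). ennreal (q z x * normal_density \<theta> 1 x))" for \<theta>
  proof -
    define g where "g x = ennreal (normal_density \<theta> 1 x / normal_density 0 1 x)" for x
    have g[measurable]: "g \<in> borel_measurable borel" unfolding g_def by measurable
    have "joint_law Z Q \<theta> = density J (\<lambda>(z, x). g x)"
    proof (rule measure_eqI)
      show "sets (joint_law Z Q \<theta>) = sets (density J (\<lambda>(z, x). g x))"
        by (simp add: J_def sets_joint_law[OF Qm])
      fix C assume "C \<in> sets (joint_law Z Q \<theta>)"
      then have C[measurable]: "C \<in> sets (Z \<Otimes>\<^sub>M borel)" by (simp add: sets_joint_law[OF Qm])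
      then have CK: "C \<in> sets K" by (simp add: sK)
      have mm[measurable]: "(\<lambda>x. emeasure (Q x) ((\<lambda>z. (z, x)) -` C)) \<in> borel_measurable borel"
        using msec'[OF CK] by (simp add: measurable_cong_sets[OF sG refl])
      have "emeasure (density J (\<lambda>(z, x). g x)) C = (\<integral>\<^sup>+w. (case w of (z, x) \<Rightarrow> g x) * indicator C w \<partial>J)"
        using CK by (intro emeasure_density) (auto simp: sJ measurable_cong_sets[OF trans[OF sJ sK] refl])
      also have "\<dots> = (\<integral>\<^sup>+x. \<integral>\<^sup>+z. g x * indicator C (z, x) \<partial>Q x \<partial>gaussian_law 0)"
        unfolding J_def by (subst nn_integral_joint_law[OF Qm]) simp_all
      also have "\<dots> = (\<integral>\<^sup>+x. g x * emeasure (Q x) ((\<lambda>z. (z, x)) -` C) \<partial>gaussian_law 0)"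
      proof (rule nn_integral_cong)
        fix x
        have "(\<integral>\<^sup>+z. g x * indicator C (z, x) \<partial>Q x) = (\<integral>\<^sup>+z. g x * indicator ((\<lambda>z. (z, x)) -` C) z \<partial>Q x)"
          by (intro nn_integral_cong) (simp add: indicator_def)
        then show "(\<integral>\<^sup>+z. g x * indicator C (z, x) \<partial>Q x) = g x * emeasure (Q x) ((\<lambda>z. (z, x)) -` C)"
          using sec[OF CK] by (simp add: nn_integral_cmult_indicator sQ)
      qed
      also have "\<dots> = (\<integral>\<^sup>+x. ennreal (normal_density 0 1 x) * (g x * emeasure (Q x) ((\<lambda>z. (z, x)) -` C)) \<partial>lborel)"
        unfolding gaussian_law_def by (intro nn_integral_density) simp_all
      also have "\<dots> = (\<integral>\<^sup>+x. ennreal (normal_density \<theta> 1 x) * emeasure (Q x) ((\<lambda>z. (z, x)) -` C) \<partial>lborel)"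
      proof (rule nn_integral_cong)
        fix x
        have "ennreal (normal_density 0 1 x) * g x = ennreal (normal_density \<theta> 1 x)"
          using normal_density_pos[of 1 0 x] normal_density_nonneg[of \<theta> 1 x]
          by (simp add: g_def ennreal_mult[symmetric])
        then show "ennreal (normal_density 0 1 x) * (g x * emeasure (Q x) ((\<lambda>z. (z, x)) -` C))
          = ennreal (normal_density \<theta> 1 x) * emeasure (Q x) ((\<lambda>z. (z, x)) -` C)"
          by (simp add: mult.assoc[symmetric])
      qed
      also have "\<dots> = (\<integral>\<^sup>+x. emeasure (Q x) ((\<lambda>z. (z, x)) -` C) \<partial>gaussian_law \<theta>)"
        unfolding gaussian_law_def by (intro nn_integral_density[symmetric]) simp_all
      also have "\<dots> = emeasure (joint_law Z Q \<theta>) C"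
        by (rule emeasure_joint_law[OF Qm C, symmetric])
      finally show "emeasure (joint_law Z Q \<theta>) C = emeasure (density J (\<lambda>(z, x). g x)) C" by simp
    qed
    also have "\<dots> = density (Q x0 \<Otimes>\<^sub>M lborel)
       (\<lambda>w. (case w of (z, x) \<Rightarrow> ennreal (normal_density 0 1 x)) * (case w of (z, x) \<Rightarrow> ennreal (q z x))
          * (case w of (z, x) \<Rightarrow> g x))"
      unfolding Jd Kd
      by (subst density_density_eq, measurable)+ (simp add: mult.assoc)
    also have "\<dots> = density (Q x0 \<Otimes>\<^sub>M lborel) (\<lambda>(z, x). ennreal (q z x * normal_density \<theta> 1 x))"
    proof (rule arg_cong[where f="density _"], rule ext)
      fix w :: "'z \<times> real"
      obtain z x where w: "w = (z, x)" by (cases w)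
      have "q z x \<ge> 0" using qb[of z x] by (auto intro: order_trans[OF exp_ge_zero])
      then show "(case w of (z, x) \<Rightarrow> ennreal (normal_density 0 1 x)) * (case w of (z, x) \<Rightarrow> ennreal (q z x))
          * (case w of (z, x) \<Rightarrow> g x) = (case w of (z, x) \<Rightarrow> ennreal (q z x * normal_density \<theta> 1 x))"
        using normal_density_pos[of 1 0 x] normal_density_nonneg[of \<theta> 1 x]
        by (simp add: w g_def ennreal_mult[symmetric])
    qed
    finally show ?thesis .
  qed
  then have "kernel_density Z Q x0 q"
    unfolding kernel_density_def using qm qb \<epsilon> by blast
  then show ?thesis by blast
qed

context
  fixes Z :: "'z measure" and Q x0 q
  assumes Qm: "Q \<in> borel \<rightarrow>\<^sub>M prob_algebra Z" and kd: "kernel_density Z Q x0 q"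
begin

lemma kernel_density_measurable: "(\<lambda>(z, x). q z x) \<in> borel_measurable (Z \<Otimes>\<^sub>M borel)"
  using kd by (simp add: kernel_density_def)

lemma kernel_density_section:
  assumes "z \<in> space Z"
  shows "q z \<in> borel_measurable borel"
  using measurable_compose[OF measurable_Pair1'[OF assms] kernel_density_measurable] by simp

lemma kernel_density_bounds:
  obtains \<epsilon> where "\<And>z x. z \<in> space Z \<Longrightarrow> q z x > 0" "\<And>z x. z \<in> space Z \<Longrightarrow> q z x \<le> exp \<epsilon>"
    "\<And>z x. z \<in> space Z \<Longrightarrow> exp (-\<epsilon>) \<le> q z x"
proof -
  obtain \<epsilon> where "\<forall>z\<in>space Z. \<forall>x. exp (-\<epsilon>) \<le> q z x \<and> q z x \<le> exp \<epsilon>"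
    using kd unfolding kernel_density_def atLeastAtMost_iff by blast
  then show thesis
    by (intro that[of \<epsilon>]) (auto intro: less_le_trans[OF exp_gt_zero])
qed

lemma kernel_density_integrable:
  assumes z: "z \<in> space Z"
  shows "integrable lborel (\<lambda>x. q z x * normal_density \<theta> 1 x)"
proof -
  obtain \<epsilon> where e: "\<And>z x. z \<in> space Z \<Longrightarrow> q z x > 0" "\<And>z x. z \<in> space Z \<Longrightarrow> q z x \<le> exp \<epsilon>"
    using kernel_density_bounds by metis
  have [measurable]: "q z \<in> borel_measurable borel" by (rule kernel_density_section[OF z])
  have "integrable lborel (\<lambda>x. exp \<epsilon> * normal_density \<theta> 1 x)"
    by (intro integrable_mult_right integrable_normal_density) simp
  then show ?thesis
    by (rule Bochner_Integration.integrable_bound)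
       (use e[OF z] in \<open>auto intro!: mult_right_mono AE_I2 simp: abs_mult less_imp_le\<close>)
qed

lemma privatized_density_pos:
  assumes z: "z \<in> space Z"
  shows "privatized_density q \<theta> z > 0"
proof -
  obtain \<epsilon> where e: "\<And>z x. z \<in> space Z \<Longrightarrow> exp (-\<epsilon>) \<le> q z x"
    using kernel_density_bounds by metis
  have "0 < exp (-\<epsilon>) * (\<integral>x. normal_density \<theta> 1 x \<partial>lborel)"
    by (simp add: integral_normal_density)
  also have "\<dots> = (\<integral>x. exp (-\<epsilon>) * normal_density \<theta> 1 x \<partial>lborel)" by simp
  also have "\<dots> \<le> privatized_density q \<theta> z"
    unfolding privatized_density_def
    by (intro integral_mono integrable_mult_right integrable_normal_density
        kernel_density_integrable[OF z] mult_right_mono e[OF z]) auto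
  finally show ?thesis .
qed

lemma ennreal_privatized_density:
  assumes z: "z \<in> space Z"
  shows "ennreal (privatized_density q \<theta> z) = (\<integral>\<^sup>+x. ennreal (q z x * normal_density \<theta> 1 x) \<partial>lborel)"
proof -
  obtain \<epsilon> where e: "\<And>z x. z \<in> space Z \<Longrightarrow> q z x > 0" using kernel_density_bounds by metis
  show ?thesis
    unfolding privatized_density_def
    by (intro nn_integral_eq_integral[symmetric] kernel_density_integrable z)
       (use e[OF z] in \<open>auto intro!: AE_I2 mult_nonneg_nonneg less_imp_le[OF e[OF z]]\<close>)
qed

lemma privatized_density_measurable: "privatized_density q \<theta> \<in> borel_measurable Z"
proof -
  note [measurable] = kernel_density_measurable
  have "(\<lambda>(z, x). q z x * normal_density \<theta> 1 x) \<in> borel_measurable (Z \<Otimes>\<^sub>M lborel)"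
    using kernel_density_measurable by (simp add: case_prod_beta')
  from lborel.borel_measurable_lebesgue_integral[OF this]
  show ?thesis by (simp add: privatized_density_def[abs_def])
qed

lemma score_measurable: "score q \<theta> \<in> borel_measurable Z"
proof -
  note [measurable] = kernel_density_measurable privatized_density_measurable
  have "(\<lambda>(z, x). (x - \<theta>) * (q z x * normal_density \<theta> 1 x / privatized_density q \<theta> z))
     \<in> borel_measurable (Z \<Otimes>\<^sub>M lborel)"
    using kernel_density_measurable by (simp add: case_prod_beta')
  from lborel.borel_measurable_lebesgue_integral[OF this]
  show ?thesis by (simp add: score_def[abs_def])
qed

lemma joint_law_marginal:
  assumes A[measurable]: "A \<in> sets Z"
  shows "emeasure (joint_law Z Q \<theta>) (A \<times> UNIV) =
     (\<integral>\<^sup>+z. ennreal (privatized_density q \<theta> z) * indicator A z \<partial>Q x0)"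
proof -
  note [measurable_cong] = kernel_facts(2)[OF Qm]
  note [measurable] = kernel_density_measurable
  have m: "(\<lambda>(z, x). ennreal (q z x * normal_density \<theta> 1 x)) \<in> borel_measurable (Q x0 \<Otimes>\<^sub>M lborel)"
    by measurable
  have "emeasure (joint_law Z Q \<theta>) (A \<times> UNIV) =
     emeasure (density (Q x0 \<Otimes>\<^sub>M lborel) (\<lambda>(z, x). ennreal (q z x * normal_density \<theta> 1 x))) (A \<times> UNIV)"
    using kd by (simp add: kernel_density_def)
  also have "\<dots> = (\<integral>\<^sup>+w. (case w of (z, x) \<Rightarrow> ennreal (q z x * normal_density \<theta> 1 x)) * indicator (A \<times> UNIV) w
     \<partial>(Q x0 \<Otimes>\<^sub>M lborel))"
    by (rule emeasure_density[OF m]) (simp add: kernel_facts(2)[OF Qm])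
  also have "\<dots> = (\<integral>\<^sup>+z. \<integral>\<^sup>+x. ennreal (q z x * normal_density \<theta> 1 x) * indicator (A \<times> UNIV) (z, x) \<partial>lborel \<partial>Q x0)"
    by (subst lborel.nn_integral_fst[symmetric]) (use m in simp_all)
  also have "\<dots> = (\<integral>\<^sup>+z. ennreal (privatized_density q \<theta> z) * indicator A z \<partial>Q x0)"
  proof (rule nn_integral_cong)
    fix z assume "z \<in> space (Q x0)"
    then have z: "z \<in> space Z" by (simp add: kernel_facts(3)[OF Qm])
    show "(\<integral>\<^sup>+x. ennreal (q z x * normal_density \<theta> 1 x) * indicator (A \<times> UNIV) (z, x) \<partial>lborel)
      = ennreal (privatized_density q \<theta> z) * indicator A z"
      by (cases "z \<in> A") (simp_all add: ennreal_privatized_density[OF z])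
  qed
  finally show ?thesis .
qed

end

lemma fisher_information_version:
  fixes Z :: "'z measure"
  assumes Qm: "Q \<in> borel \<rightarrow>\<^sub>M prob_algebra Z"
    and q: "kernel_density Z Q x0 q" and r: "kernel_density Z Q x1 r"
  shows "(\<integral>z. (score r \<theta> z)\<^sup>2 * privatized_density r \<theta> z \<partial>Q x1)
       = (\<integral>z. (score q \<theta> z)\<^sup>2 * privatized_density q \<theta> z \<partial>Q x0)"
proof -
  note sQ[measurable_cong] = kernel_facts(2)[OF Qm]
  note spQ = kernel_facts(3)[OF Qm]
  interpret Qp: prob_space "Q x" for x by (rule kernel_facts(4)[OF Qm])
  interpret P: pair_sigma_finite "Q x0" lborel ..
  note qm[measurable] = kernel_density_measurable[OF Qm q]
  note rm[measurable] = kernel_density_measurable[OF Qm r]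
  note [measurable] = privatized_density_measurable[OF Qm q] privatized_density_measurable[OF Qm r]
    score_measurable[OF Qm q] score_measurable[OF Qm r]
  note qpos = privatized_density_pos[OF Qm q] and rpos = privatized_density_pos[OF Qm r]
  define h where "h z = privatized_density q 0 z / privatized_density r 0 z" for z
  have hm[measurable]: "h \<in> borel_measurable Z" unfolding h_def by measurable
  have hpos: "z \<in> space Z \<Longrightarrow> h z > 0" for z by (simp add: h_def qpos rpos)
  have marg: "density (Q x0) (\<lambda>z. ennreal (privatized_density q 0 z))
      = density (Q x1) (\<lambda>z. ennreal (privatized_density r 0 z))"
  proof (rule measure_eqI)
    fix A assume "A \<in> sets (density (Q x0) (\<lambda>z. ennreal (privatized_density q 0 z)))"
    then have A: "A \<in> sets Z" by (simp add: sQ)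
    show "emeasure (density (Q x0) (\<lambda>z. ennreal (privatized_density q 0 z))) A
      = emeasure (density (Q x1) (\<lambda>z. ennreal (privatized_density r 0 z))) A"
      using joint_law_marginal[OF Qm q A, of 0] joint_law_marginal[OF Qm r A, of 0] A
      by (simp add: emeasure_density sQ)
  qed (simp add: sQ)
  have dens: "Q x1 = density (Q x0) (\<lambda>z. ennreal (h z))"
  proof -
    have "Q x1 = density (Q x1) (\<lambda>z. ennreal (privatized_density r 0 z) * ennreal (1 / privatized_density r 0 z))"
      by (subst density_1[symmetric], rule density_cong)
         (auto intro!: AE_I2 simp: spQ rpos ennreal_mult[symmetric] less_imp_le less_imp_neq[OF rpos, symmetric])
    also have "\<dots> = density (density (Q x0) (\<lambda>z. ennreal (privatized_density q 0 z))) (\<lambda>z. ennreal (1 / privatized_density r 0 z))"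
      unfolding marg by (rule density_density_eq[symmetric]) measurable
    also have "\<dots> = density (Q x0) (\<lambda>z. ennreal (privatized_density q 0 z) * ennreal (1 / privatized_density r 0 z))"
      by (rule density_density_eq) measurable
    also have "\<dots> = density (Q x0) (\<lambda>z. ennreal (h z))"
      by (rule density_cong)
         (auto intro!: AE_I2 simp: spQ qpos rpos ennreal_mult[symmetric] less_imp_le h_def)
    finally show ?thesis .
  qed
  have prod: "Q x1 \<Otimes>\<^sub>M lborel = density (Q x0 \<Otimes>\<^sub>M lborel) (\<lambda>(z, x). ennreal (h z))"
  proof -
    have "density (Q x0) (\<lambda>z. ennreal (h z)) \<Otimes>\<^sub>M density lborel (\<lambda>_. 1)
      = density (Q x0 \<Otimes>\<^sub>M lborel) (\<lambda>(z, x). ennreal (h z) * 1)"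
      by (intro pair_measure_density) (auto simp: density_1 intro: lborel.sigma_finite_measure_axioms)
    then show ?thesis by (simp add: dens[symmetric] density_1)
  qed
  have "density (Q x0 \<Otimes>\<^sub>M lborel) (\<lambda>(z, x). ennreal (q z x * normal_density 0 1 x)) =
     density (Q x1 \<Otimes>\<^sub>M lborel) (\<lambda>(z, x). ennreal (r z x * normal_density 0 1 x))"
    using q r by (simp add: kernel_density_def)
  also have "\<dots> = density (Q x0 \<Otimes>\<^sub>M lborel)
      (\<lambda>w. (case w of (z, x) \<Rightarrow> ennreal (h z)) * (case w of (z, x) \<Rightarrow> ennreal (r z x * normal_density 0 1 x)))"
    unfolding prod by (rule density_density_eq) measurable
  finally have "AE w in Q x0 \<Otimes>\<^sub>M lborel. (case w of (z, x) \<Rightarrow> ennreal (q z x * normal_density 0 1 x)) =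
     (case w of (z, x) \<Rightarrow> ennreal (h z)) * (case w of (z, x) \<Rightarrow> ennreal (r z x * normal_density 0 1 x))"
    by (intro P.density_unique) measurable
  from P.AE_pair[OF this]
  have ae: "AE z in Q x0. AE x in lborel. ennreal (q z x * normal_density 0 1 x) =
     ennreal (h z) * ennreal (r z x * normal_density 0 1 x)" by simp
  obtain e where qp: "\<And>z x. z \<in> space Z \<Longrightarrow> q z x > 0" using kernel_density_bounds[OF Qm q] by metis
  obtain e where rp: "\<And>z x. z \<in> space Z \<Longrightarrow> r z x > 0" using kernel_density_bounds[OF Qm r] by metis
  have ae': "AE z in Q x0. privatized_density q \<theta> z = h z * privatized_density r \<theta> z
     \<and> score q \<theta> z = score r \<theta> z"
    using ae AE_space
  proof eventually_elim
    case (elim z)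
    then have z: "z \<in> space Z" by (simp add: spQ)
    have [measurable]: "q z \<in> borel_measurable borel" "r z \<in> borel_measurable borel"
      by (rule kernel_density_section[OF Qm q z], rule kernel_density_section[OF Qm r z])
    have aex: "AE x in lborel. q z x = h z * r z x"
      using elim(1)
    proof eventually_elim
      case (elim x)
      have p: "normal_density 0 1 x > 0" by (simp add: normal_density_pos)
      have "q z x * normal_density 0 1 x = h z * (r z x * normal_density 0 1 x)"
        using elim p qp[OF z, of x] rp[OF z, of x] hpos[OF z]
        by (simp add: ennreal_mult[symmetric] less_imp_le)
      then show ?case using p by simp
    qed
    have "privatized_density q \<theta> z = (\<integral>x. h z * (r z x * normal_density \<theta> 1 x) \<partial>lborel)"
      unfolding privatized_density_def
      by (rule integral_cong_AE) (use aex in \<open>auto elim!: eventually_mono\<close>)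
    then have 1: "privatized_density q \<theta> z = h z * privatized_density r \<theta> z"
      by (simp add: privatized_density_def)
    have "score q \<theta> z = score r \<theta> z"
      unfolding score_def 1
      by (rule integral_cong_AE) (use aex hpos[OF z] in \<open>auto elim!: eventually_mono\<close>)
    with 1 show ?case by simp
  qed
  have "(\<integral>z. (score r \<theta> z)\<^sup>2 * privatized_density r \<theta> z \<partial>Q x1)
     = (\<integral>z. h z * ((score r \<theta> z)\<^sup>2 * privatized_density r \<theta> z) \<partial>Q x0)"
    unfolding dens
    by (rule integral_real_density) (auto intro!: AE_I2 less_imp_le[OF hpos] simp: spQ)
  also have "\<dots> = (\<integral>z. (score q \<theta> z)\<^sup>2 * privatized_density q \<theta> z \<partial>Q x0)"
  proof (rule integral_cong_AE)
    show "AE z in Q x0. h z * ((score r \<theta> z)\<^sup>2 * privatized_density r \<theta> z)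
        = (score q \<theta> z)\<^sup>2 * privatized_density q \<theta> z"
      using ae' by eventually_elim simp
  qed measurable
  finally show ?thesis .
qed

lemma fisher_information_eq:
  assumes "Q \<in> ldp_mechanisms \<epsilon> Z" and "kernel_density Z Q x0 q"
  shows "fisher_information Z Q \<theta> =
     (\<integral>z. (score q \<theta> z)\<^sup>2 * privatized_density q \<theta> z \<partial>Q x0)"
  unfolding fisher_information_def
proof (rule the_equality)
  show "\<exists>y p. kernel_density Z Q y p \<and>
      (\<integral>z. (score q \<theta> z)\<^sup>2 * privatized_density q \<theta> z \<partial>Q x0)
        = (\<integral>z. (score p \<theta> z)\<^sup>2 * privatized_density p \<theta> z \<partial>Q y)"
    using assms(2) by blast
qed (use assms in \<open>auto simp: ldp_mechanisms_def intro: fisher_information_version\<close>)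

lemma privatized_law:
  assumes Qm: "Q \<in> borel \<rightarrow>\<^sub>M prob_algebra Z" and q: "kernel_density Z Q x0 q"
  shows "gaussian_law \<theta> \<bind> Q = density (Q x0) (\<lambda>z. ennreal (privatized_density q \<theta> z))"
proof (rule measure_eqI)
  have Q': "Q \<in> gaussian_law \<theta> \<rightarrow>\<^sub>M subprob_algebra Z"
    using kernel_facts(1)[OF Qm] by (simp add: measurable_cong_sets[OF sets_gaussian_law refl])
  have ne: "space (gaussian_law \<theta>) \<noteq> {}" by (simp add: gaussian_law_def)
  have s: "sets (gaussian_law \<theta> \<bind> Q) = sets Z"
    by (rule sets_bind_measurable[OF Q' ne])
  then show "sets (gaussian_law \<theta> \<bind> Q) = sets (density (Q x0) (\<lambda>z. ennreal (privatized_density q \<theta> z)))"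
    by (simp add: kernel_facts(2)[OF Qm])
  fix A assume "A \<in> sets (gaussian_law \<theta> \<bind> Q)"
  then have A: "A \<in> sets Z" by (simp add: s)
  have m: "(\<lambda>z. ennreal (privatized_density q \<theta> z)) \<in> borel_measurable (Q x0)"
    using privatized_density_measurable[OF Qm q]
    by (simp add: measurable_cong_sets[OF kernel_facts(2)[OF Qm] refl])
  have "emeasure (gaussian_law \<theta> \<bind> Q) A = (\<integral>\<^sup>+x. emeasure (Q x) A \<partial>gaussian_law \<theta>)"
    by (rule emeasure_bind[OF ne Q' A])
  also have "\<dots> = emeasure (joint_law Z Q \<theta>) (A \<times> UNIV)"
    using A by (subst emeasure_joint_law[OF Qm]) (auto simp: vimage_def)
  also have "\<dots> = emeasure (density (Q x0) (\<lambda>z. ennreal (privatized_density q \<theta> z))) A"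
    unfolding joint_law_marginal[OF Qm q A]
    using A by (intro emeasure_density[OF m, symmetric]) (simp add: kernel_facts(2)[OF Qm])
  finally show "emeasure (gaussian_law \<theta> \<bind> Q) A
      = emeasure (density (Q x0) (\<lambda>z. ennreal (privatized_density q \<theta> z))) A" .
qed

lemma score_eq_log_derivative:
  fixes Z :: "'z measure"
  assumes Qm: "Q \<in> borel \<rightarrow>\<^sub>M prob_algebra Z" and q: "kernel_density Z Q x0 q" and z: "z \<in> space Z"
  shows "((\<lambda>t. ln (privatized_density q t z)) has_real_derivative score q \<theta> z) (at \<theta>)"
proof -
  obtain e where qp: "\<And>x. q z x > 0" and qe: "\<And>x. q z x \<le> exp e"
    using kernel_density_bounds[OF Qm q] z by metis
  have qm[measurable]: "q z \<in> borel_measurable borel" by (rule kernel_density_section[OF Qm q z])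
  define p where "p = normal_density \<theta> 1"
  have pm[measurable]: "p \<in> borel_measurable borel" unfolding p_def by simp
  have p0: "p x \<ge> 0" for x by (simp add: p_def)
  have shift: "normal_density (\<theta> + h) 1 x = p x * exp (h * (x - \<theta>) - h\<^sup>2 / 2)" for h x
    unfolding p_def normal_density_def
    by (simp add: mult_exp_exp) (simp add: power2_eq_square field_simps)
  define W where "W x = exp (2 * (x - \<theta>)) + exp (- 2 * (x - \<theta>))" for x
  have Wint: "integrable lborel (\<lambda>x. p x * W x)"
  proof -
    have "p x * W x = exp 2 * normal_density (\<theta> + 2) 1 x + exp 2 * normal_density (\<theta> + -2) 1 x" for x
      unfolding shift W_def by (simp add: exp_diff exp_add exp_minus field_simps)
    then show ?thesis
      by (simp only:) (intro Bochner_Integration.integrable_add integrable_mult_right integrable_normal_density, simp_all)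
  qed
  have bound: "\<bar>exp (h * u - h\<^sup>2 / 2) - 1\<bar> \<le> \<bar>h\<bar> * (exp (2 * u) + exp (- 2 * u))"
    if h: "\<bar>h\<bar> \<le> 1" for h u :: real
  proof -
    define G where "G t = exp (t * u - t\<^sup>2 / 2)" for t
    have der: "(G has_field_derivative ((u - t) * G t)) (at t within {-1..1})" for t
      unfolding G_def by (auto intro!: derivative_eq_intros simp: algebra_simps)
    have "norm ((u - t) * G t) \<le> exp (2 * \<bar>u\<bar>)" if t: "t \<in> {-1..1}" for t
    proof -
      have "\<bar>u - t\<bar> \<le> 1 + \<bar>u\<bar>" using t unfolding atLeastAtMost_iff by arith
      also have "\<dots> \<le> exp \<bar>u\<bar>" by (rule exp_ge_add_one_self)
      finally have "\<bar>u - t\<bar> \<le> exp \<bar>u\<bar>" .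
      moreover have "t * u \<le> \<bar>u\<bar>"
      proof -
        have "t * u \<le> \<bar>t\<bar> * \<bar>u\<bar>" by (metis abs_ge_self abs_mult)
        also have "\<dots> \<le> 1 * \<bar>u\<bar>" using t by (intro mult_right_mono) auto
        finally show ?thesis by simp
      qed
      then have "t * u - t\<^sup>2 / 2 \<le> \<bar>u\<bar>" using zero_le_power2[of t] by linarith
      then have "G t \<le> exp \<bar>u\<bar>" unfolding G_def by (subst exp_le_cancel_iff)
      ultimately have "\<bar>u - t\<bar> * G t \<le> exp \<bar>u\<bar> * exp \<bar>u\<bar>"
        by (intro mult_mono) (auto simp: G_def)
      then show ?thesis by (simp add: abs_mult G_def mult_exp_exp)
    qed
    then have "norm (G h - G 0) \<le> exp (2 * \<bar>u\<bar>) * norm (h - 0)"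
      using h by (intro field_differentiable_bound[where S="{-1..1}" and f'="\<lambda>t. (u - t) * G t"] der) auto
    moreover have "exp (2 * \<bar>u\<bar>) \<le> exp (2 * u) + exp (- 2 * u)"
      by (cases "u \<ge> 0") auto
    then have "exp (2 * \<bar>u\<bar>) * norm (h - 0) \<le> (exp (2 * u) + exp (- 2 * u)) * \<bar>h\<bar>"
      by (simp only: diff_0_right real_norm_def) (rule mult_right_mono, simp_all)
    ultimately have "\<bar>G h - G 0\<bar> \<le> (exp (2 * u) + exp (- 2 * u)) * \<bar>h\<bar>"
      unfolding real_norm_def by (rule order_trans)
    then show ?thesis by (simp add: G_def mult.commute)
  qed
  define F where "F t = privatized_density q t z" for t
  define D where "D = (\<integral>x. q z x * p x * (x - \<theta>) \<partial>lborel)"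
  have quot: "(F (\<theta> + h) - F \<theta>) / h = (\<integral>x. q z x * p x * ((exp (h * (x - \<theta>) - h\<^sup>2 / 2) - 1) / h) \<partial>lborel)" for h
  proof -
    have factor: "(a * (b * c) - a * b) / k = a * b * ((c - 1) / k)" for a b c k :: real
      by (simp add: right_diff_distrib diff_divide_distrib mult.assoc)
    have diff: "F (\<theta> + h) - F \<theta> = (\<integral>x. q z x * normal_density (\<theta> + h) 1 x - q z x * normal_density \<theta> 1 x \<partial>lborel)"
      unfolding F_def privatized_density_def
      by (intro Bochner_Integration.integral_diff[symmetric] kernel_density_integrable[OF Qm q z])
    have "(F (\<theta> + h) - F \<theta>) / h = (\<integral>x. (q z x * normal_density (\<theta> + h) 1 x - q z x * normal_density \<theta> 1 x) / h \<partial>lborel)"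
      unfolding diff by simp
    also have "\<dots> = (\<integral>x. q z x * p x * ((exp (h * (x - \<theta>) - h\<^sup>2 / 2) - 1) / h) \<partial>lborel)"
      unfolding shift p_def by (intro Bochner_Integration.integral_cong refl) (rule factor)
    finally show ?thesis .
  qed
  have lim: "((\<lambda>h. \<integral>x. q z x * p x * ((exp (h * (x - \<theta>) - h\<^sup>2 / 2) - 1) / h) \<partial>lborel) \<longlongrightarrow> D) (at 0)"
    unfolding tendsto_at_iff_sequentially comp_def
  proof (intro allI impI)
    fix X :: "nat \<Rightarrow> real" assume X0: "\<forall>i. X i \<in> UNIV - {0}" and X: "X \<longlonglongrightarrow> 0"
    define Y where "Y i = (if \<bar>X i\<bar> \<le> 1 then X i else 1)" for i
    have Yb: "\<bar>Y i\<bar> \<le> 1" "Y i \<noteq> 0" for i using X0 by (auto simp: Y_def)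
    have ev: "eventually (\<lambda>i. Y i = X i) sequentially"
      using tendstoD[OF X, of 1] by (auto simp: Y_def elim!: eventually_mono)
    have Y: "Y \<longlonglongrightarrow> 0" using X ev by (metis tendsto_cong)
    have "(\<lambda>i. \<integral>x. q z x * p x * ((exp (Y i * (x - \<theta>) - (Y i)\<^sup>2 / 2) - 1) / Y i) \<partial>lborel) \<longlonglongrightarrow> D"
      unfolding D_def
    proof (rule integral_dominated_convergence[where w="\<lambda>x. exp e * (p x * W x)"])
      show "integrable lborel (\<lambda>x. exp e * (p x * W x))" using Wint by simp
      show "AE x in lborel. (\<lambda>i. q z x * p x * ((exp (Y i * (x - \<theta>) - (Y i)\<^sup>2 / 2) - 1) / Y i))
          \<longlonglongrightarrow> q z x * p x * (x - \<theta>)"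
      proof (intro AE_I2 tendsto_mult tendsto_const)
        fix x
        have "((\<lambda>t. exp (t * (x - \<theta>) - t\<^sup>2 / 2)) has_real_derivative (x - \<theta>)) (at 0)"
          by (auto intro!: derivative_eq_intros)
        then have "((\<lambda>h. (exp (h * (x - \<theta>) - h\<^sup>2 / 2) - 1) / h) \<longlongrightarrow> x - \<theta>) (at 0)"
          by (simp add: DERIV_def)
        moreover have "filterlim Y (at 0) sequentially"
          using Y Yb(2) by (auto simp: filterlim_at)
        ultimately show "(\<lambda>i. (exp (Y i * (x - \<theta>) - (Y i)\<^sup>2 / 2) - 1) / Y i) \<longlonglongrightarrow> x - \<theta>"
          by (rule filterlim_compose)
      qed
      show "AE x in lborel. norm (q z x * p x * ((exp (Y i * (x - \<theta>) - (Y i)\<^sup>2 / 2) - 1) / Y i))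
          \<le> exp e * (p x * W x)" for i
      proof (rule AE_I2)
        fix x
        have "\<bar>(exp (Y i * (x - \<theta>) - (Y i)\<^sup>2 / 2) - 1) / Y i\<bar> \<le> W x"
          using bound[OF Yb(1), of i "x - \<theta>"] Yb(2)[of i]
          by (simp add: W_def abs_divide field_simps)
        then have "q z x * p x * \<bar>(exp (Y i * (x - \<theta>) - (Y i)\<^sup>2 / 2) - 1) / Y i\<bar> \<le> exp e * p x * W x"
          using qp[of x] qe[of x] p0[of x] by (intro mult_mono) auto
        then show "norm (q z x * p x * ((exp (Y i * (x - \<theta>) - (Y i)\<^sup>2 / 2) - 1) / Y i)) \<le> exp e * (p x * W x)"
          using qp[of x] p0[of x] by (simp add: abs_mult mult.assoc)
      qed
    qed measurable
    moreover have "eventually (\<lambda>i. (\<integral>x. q z x * p x * ((exp (Y i * (x - \<theta>) - (Y i)\<^sup>2 / 2) - 1) / Y i) \<partial>lborel)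
        = (\<integral>x. q z x * p x * ((exp (X i * (x - \<theta>) - (X i)\<^sup>2 / 2) - 1) / X i) \<partial>lborel)) sequentially"
      using ev by eventually_elim simp
    ultimately show "(\<lambda>i. \<integral>x. q z x * p x * ((exp (X i * (x - \<theta>) - (X i)\<^sup>2 / 2) - 1) / X i) \<partial>lborel) \<longlonglongrightarrow> D"
      by (rule Lim_transform_eventually)
  qed
  have "(F has_real_derivative D) (at \<theta>)"
    unfolding DERIV_def quot by (rule lim)
  moreover have "F \<theta> > 0" unfolding F_def by (rule privatized_density_pos[OF Qm q z])
  ultimately have "((\<lambda>t. ln (F t)) has_real_derivative (1 / F \<theta>) * D) (at \<theta>)"
    by (intro DERIV_chain2[OF DERIV_ln_divide])
  moreover have "(1 / F \<theta>) * D = score q \<theta> z"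
    unfolding score_def D_def F_def p_def
    by (subst integral_mult_right_zero[symmetric]) (intro Bochner_Integration.integral_cong refl, simp add: field_simps)
  ultimately show ?thesis by (simp add: F_def)
qed

end

(* Write tau = tanh (eps / 2) and c = sqrt (2 / pi) * tau. The Fisher information is the maximum over
   functions T of the expectation of 2 T(Z) (X - theta) - T(Z)^2, attained at the score. The dual
   certificate is the even function g(y) = 2 tau c |y| - c^2, whose standard normal mean is c^2: it
   suffices that slack(y) = g(y) - 2 t y + t^2 has nonnegative expectation at t = T(Z), y = X - theta
   under every private mechanism. Privacy allows a mechanism to favour the negative part of slack over the
   positive part by a factor of at most exp eps, so everything reduces to the one-dimensional
   inequality exp eps * E(slack^-) <= E(slack^+) for all real t, with equality at t = c and t = -c
   (the scores of the sign mechanism). *)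

theory Submission
  imports Defs
begin

subsection \<open>The one-dimensional inequality\<close>

text \<open>The obstacle is that the one-dimensional inequality is an equality at
  \<open>t = c\<close>, so a lossy estimate fails near \<open>c\<close>: its error must vanish
  quadratically there. The negative part of \<open>slack\<close> is piecewise linear in y, and its
  exact integral involves the normal distribution function at a zero that moves with t. Error
  functions are avoided by splitting off a linear function on a half-line, whose Gaussian integral
  is exact, and covering the rest by triangles with a vertex over 0, on which the density is
  replaced by its maximum. A triangle of height \<open>|c^2 - t^2|\<close> whose slope stays away
  from 0 has area of order \<open>(t - c)^2\<close> near \<open>c\<close>, the same order as the
  available gap, so only constants have to be compared. These comparisons rest on
  \<open>pi >= 3\<close> and \<open>\<tau> <= 1 / 2\<close>; the latter is
  \<open>exp \<epsilon> <= 3\<close>, which is how the bound on the privacy level enters.\<close>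

lemma pi_ge_three: "3 \<le> pi"
  using sin_x_le_x[of "pi / 6"] by (simp add: sin_30)

lemma std_normal_density_le: "std_normal_density x \<le> sqrt (2 / pi) / 2"
proof -
  have "sqrt (2 / pi) / 2 = 1 / sqrt (2 * pi)"
    by (simp add: real_sqrt_divide real_sqrt_mult field_simps)
  then show ?thesis
    unfolding std_normal_density_def by (simp add: divide_right_mono)
qed

lemma has_bochner_integral_std_normal:
  "has_bochner_integral lborel (\<lambda>x. std_normal_density x) 1"
  using std_normal_moment_even[of 0] by simp

lemma has_bochner_integral_std_normal_abs:
  "has_bochner_integral lborel (\<lambda>x. std_normal_density x * \<bar>x\<bar>) (sqrt (2 / pi))"
  using std_normal_moment_abs_odd[of 0] by simp

lemma has_bochner_integral_std_normal_id:
  "has_bochner_integral lborel (\<lambda>x. std_normal_density x * x) 0"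
  using std_normal_moment_odd[of 0] by simp

text \<open>The constant part is half of the total mass by evenness; on the half-line x equals
  \<open>(\<bar>x\<bar> + x) / 2\<close>, so the linear part comes from the absolute and the signed
  first moment.\<close>

lemma has_bochner_integral_half_std_normal:
  "has_bochner_integral lborel (\<lambda>x. indicator {0..} x * (p + r * x) * std_normal_density x)
     (p / 2 + r * sqrt (2 / pi) / 2)"
proof -
  have "integrable lborel (\<lambda>x. indicator {0..} x *\<^sub>R std_normal_density x)"
    by (intro integrable_mult_indicator integrable_normal_density) auto
  then obtain I where I: "has_bochner_integral lborel (\<lambda>x. indicator {0..} x *\<^sub>R std_normal_density x) I"
    unfolding integrable.simps by blast
  have "has_bochner_integral lborel std_normal_density (2 *\<^sub>R I)"
    by (rule has_bochner_integral_even_function[OF I]) (simp add: normal_density_def)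
  then have "2 *\<^sub>R I = 1"
    using has_bochner_integral_std_normal by (rule has_bochner_integral_eq)
  then have I2: "I = 1 / 2" by simp
  have "has_bochner_integral lborel (\<lambda>x. p * (indicator {0..} x *\<^sub>R std_normal_density x)
      + r * ((std_normal_density x * \<bar>x\<bar> + std_normal_density x * x) / 2))
      (p * (1 / 2) + r * ((sqrt (2 / pi) + 0) / 2))"
    using I unfolding I2
    by (intro has_bochner_integral_add has_bochner_integral_mult_right has_bochner_integral_divide_zero
        has_bochner_integral_std_normal_abs has_bochner_integral_std_normal_id)
      auto
  moreover have "p * (indicator {0..} x *\<^sub>R std_normal_density x)
      + r * ((std_normal_density x * \<bar>x\<bar> + std_normal_density x * x) / 2)
      = indicator {0..} x * (p + r * x) * std_normal_density x" for x
    by (auto simp: indicator_def algebra_simps)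
  ultimately show ?thesis by simp
qed

text \<open>On the two compact intervals the normal density is replaced by its maximum.\<close>

lemma integral_positive_part_le:
  fixes v :: "real \<Rightarrow> real"
  assumes nonneg: "0 \<le> A" "0 \<le> B" "0 \<le> \<beta>" "0 \<le> \<gamma>"
    and v: "\<And>x. max 0 (v x) \<le> indicator {0..} x * (p + r * x)
      + indicator {-\<beta>..0} x * (A * (x + \<beta>)) + indicator {0..\<gamma>} x * (B * (\<gamma> - x))"
  shows "(\<integral>x. max 0 (v x) * std_normal_density x \<partial>lborel)
    \<le> p / 2 + r * sqrt (2 / pi) / 2 + sqrt (2 / pi) / 4 * (A * \<beta>\<^sup>2 + B * \<gamma>\<^sup>2)"
proof -
  let ?\<kappa> = "sqrt (2 / pi)"
  let ?l = "\<lambda>x. indicator {-\<beta>..0} x * (A * (x + \<beta>))"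
  let ?r = "\<lambda>x. indicator {0..\<gamma>} x * (B * (\<gamma> - x))"
  let ?U = "\<lambda>x. indicator {0..} x * (p + r * x) * std_normal_density x + ?\<kappa> / 2 * ?l x + ?\<kappa> / 2 * ?r x"
  have l: "has_bochner_integral lborel ?l (A * \<beta>\<^sup>2 / 2)"
  proof -
    have "has_bochner_integral lborel (\<lambda>x. (A * (x + \<beta>)) * indicator {-\<beta>..0} x)
        (A * (0 + \<beta>)\<^sup>2 / 2 - A * (-\<beta> + \<beta>)\<^sup>2 / 2)"
      using nonneg by (intro has_bochner_integral_FTC_Icc_real) (auto intro!: derivative_eq_intros)
    then show ?thesis by (simp add: mult.commute)
  qed
  have r: "has_bochner_integral lborel ?r (B * \<gamma>\<^sup>2 / 2)"
  proof -
    have "has_bochner_integral lborel (\<lambda>x. (B * (\<gamma> - x)) * indicator {0..\<gamma>} x)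
        (- (B * (\<gamma> - \<gamma>)\<^sup>2 / 2) - - (B * (\<gamma> - 0)\<^sup>2 / 2))"
      using nonneg by (intro has_bochner_integral_FTC_Icc_real) (auto intro!: derivative_eq_intros simp: field_simps)
    then show ?thesis by (simp add: mult.commute)
  qed
  have U: "has_bochner_integral lborel ?U (p / 2 + r * ?\<kappa> / 2 + ?\<kappa> / 2 * (A * \<beta>\<^sup>2 / 2) + ?\<kappa> / 2 * (B * \<gamma>\<^sup>2 / 2))"
    by (intro has_bochner_integral_add has_bochner_integral_half_std_normal has_bochner_integral_mult_right l r)
  have le: "max 0 (v x) * std_normal_density x \<le> ?U x" for x
  proof -
    have lr: "0 \<le> ?l x" "0 \<le> ?r x" using nonneg by (auto simp: indicator_def)
    have "max 0 (v x) * std_normal_density x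
      \<le> (indicator {0..} x * (p + r * x) + ?l x + ?r x) * std_normal_density x"
      by (intro mult_right_mono v) simp
    also have "\<dots> \<le> ?U x"
      using mult_right_mono[OF std_normal_density_le lr(1), of x] mult_right_mono[OF std_normal_density_le lr(2), of x]
      by (simp add: algebra_simps)
    finally show ?thesis .
  qed
  \<comment> \<open>\<open>integral_mono'\<close> takes integrability from the bound alone. A
    non-integrable left-hand side would have integral 0, hence the extra obligation that
    \<open>?U\<close> be nonnegative.\<close>
  have "(\<integral>x. max 0 (v x) * std_normal_density x \<partial>lborel) \<le> (\<integral>x. ?U x \<partial>lborel)"
  proof (rule integral_mono')
    show "integrable lborel ?U" using U by (rule integrable.intros)
    show "0 \<le> ?U x" for x
      by (rule order_trans[OF _ le]) simp
  qed (rule le)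
  also have "\<dots> = p / 2 + r * ?\<kappa> / 2 + ?\<kappa> / 4 * (A * \<beta>\<^sup>2 + B * \<gamma>\<^sup>2)"
    using has_bochner_integral_integral_eq[OF U] by (simp add: algebra_simps)
  finally show ?thesis .
qed

definition opt_score :: "real \<Rightarrow> real" where
  "opt_score \<tau> = sqrt (2 / pi) * \<tau>"

text \<open>The coefficients come from demanding equality at \<open>t = c\<close>, where c is
  \<open>opt_score \<tau>\<close>. There the expression is
  \<open>2 * c * (\<tau> * \<bar>y\<bar> - y)\<close>: it changes sign at 0 only, like the sign
  mechanism, and its slopes on the two sides are in the ratio
  \<open>(1 + \<tau>) / (1 - \<tau>)\<close>, which is \<open>exp \<epsilon>\<close>.\<close>

definition slack :: "real \<Rightarrow> real \<Rightarrow> real \<Rightarrow> real" where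
  "slack \<tau> t y = 2 * \<tau> * opt_score \<tau> * \<bar>y\<bar> - (opt_score \<tau>)\<^sup>2 - 2 * t * y + t\<^sup>2"

text \<open>The positive part exceeds the negative part by the mean \<open>t^2 + c^2\<close> of
  \<open>slack\<close>, and \<open>exp \<epsilon> - 1\<close> is
  \<open>2 * \<tau> / (1 - \<tau>)\<close>. Eliminating the positive part from the balance leaves
  this upper bound on the negative part; negative t follow by reflection.\<close>

lemma integral_negative_slack_le:
  assumes \<tau>: "0 < \<tau>" "\<tau> \<le> 1 / 2" and t: "0 \<le> t"
  shows "2 * \<tau> / (1 - \<tau>) * (\<integral>x. max 0 (- slack \<tau> t x) * std_normal_density x \<partial>lborel)
    \<le> t\<^sup>2 + (opt_score \<tau>)\<^sup>2"
proof -
  define \<kappa> where "\<kappa> = sqrt (2 / pi)"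
  define c where "c = opt_score \<tau>"
  define s where "s = \<tau> * c"
  define I where "I = (\<integral>x. max 0 (- slack \<tau> t x) * std_normal_density x \<partial>lborel)"
  have \<kappa>: "0 < \<kappa>" "\<kappa>\<^sup>2 \<le> 2 / 3"
    using pi_ge_three by (auto simp: \<kappa>_def divide_le_eq)
  have c: "c = \<kappa> * \<tau>" "0 < c" using \<kappa> \<tau> by (auto simp: c_def opt_score_def \<kappa>_def)
  have s0: "0 < s" using c \<tau> by (simp add: s_def)
  have sc: "s \<le> c / 2" using mult_right_mono[OF \<tau>(2), of c] c by (simp add: s_def)
  have c2: "c\<^sup>2 \<le> 2 / 3 * \<tau>\<^sup>2"
    using mult_right_mono[OF \<kappa>(2), of "\<tau>\<^sup>2"] by (simp add: c power_mult_distrib)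
  have c3: "c\<^sup>2 \<le> \<tau> / 3" using c2 \<tau>(1) mult_left_mono[OF \<tau>(2), of \<tau>] unfolding power2_eq_square by linarith
  have c6: "c\<^sup>2 \<le> 1 / 6" using c3 \<tau> by simp
  note v = integral_positive_part_le[of _ _ _ _ "\<lambda>x. - slack \<tau> t x", folded I_def \<kappa>_def]
  have slack: "- slack \<tau> t x = 2 * t * x - t\<^sup>2 + c\<^sup>2 - 2 * s * \<bar>x\<bar>" for x
    by (simp add: slack_def c_def s_def)
  have goal: ?thesis if "2 * \<tau> * I \<le> (1 - \<tau>) * (t\<^sup>2 + c\<^sup>2)"
    unfolding I_def[symmetric] c_def[symmetric] using that \<tau> by (simp add: pos_divide_le_eq mult.commute)
  \<comment> \<open>The half-line part leaves exactly \<open>(t - c)\<^sup>2\<close> to spare. For \<open>t\<close> near \<open>c\<close> the compact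
    intervals have length of order \<open>\<bar>t - c\<bar>\<close>, so their contribution is of the same order.\<close>
  have main: "(1 - \<tau>) * (t\<^sup>2 + c\<^sup>2) - 2 * \<tau> * ((c\<^sup>2 - t\<^sup>2) / 2 + 2 * (t - s) * \<kappa> / 2) = (t - c)\<^sup>2"
    unfolding s_def c by (simp add: power2_eq_square field_simps)
  \<comment> \<open>The cost of one triangle of height \<open>k\<close> and slope
    \<open>2 * d\<close>, hence of base \<open>k / (2 * d)\<close>.\<close>
  have sq: "2 * \<tau> * (\<kappa> / 4 * (2 * d * (k / (2 * d))\<^sup>2)) = c * k\<^sup>2 / (4 * d)" if "d \<noteq> 0" for d k
    using that unfolding c by (simp add: power2_eq_square field_simps)
  \<comment> \<open>\<open>- slack\<close> has the value \<open>c^2 - t^2\<close> at 0, with a sign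
    change at \<open>t = c\<close>, and slope \<open>2 * (t - s)\<close> to the right of 0, with a
    sign change at \<open>t = s\<close>. Below \<open>s / 2\<close> the right slope is bounded away
    from 0. The triangle cost grows like the cube of t, against a quadratic gap, so large t are cut
    off at \<open>4 * c\<close>.\<close>
  consider "4 * c \<le> t" | "c \<le> t" "t \<le> 4 * c" | "s \<le> t" "t \<le> c" | "s / 2 \<le> t" "t \<le> s" | "t \<le> s / 2"
    by linarith
  then show ?thesis
  proof cases
    case 1
    have tc: "c\<^sup>2 \<le> t\<^sup>2" using 1 c by (intro power_mono) auto
    have "I \<le> 0 / 2 + 2 * (t - s) * \<kappa> / 2 + \<kappa> / 4 * (0 * 0\<^sup>2 + 0 * 0\<^sup>2)"
    proof (rule v)
      fix x
      show "max 0 (- slack \<tau> t x) \<le> indicator {0..} x * (0 + 2 * (t - s) * x)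
        + indicator {- 0..0} x * (0 * (x + 0)) + indicator {0..0} x * (0 * (0 - x))"
      proof (cases "x \<ge> 0")
        case True
        then have "0 \<le> (t - s) * x" using 1 c sc by (intro mult_nonneg_nonneg) auto
        then show ?thesis using True tc unfolding slack by (simp add: algebra_simps)
      next
        case False
        then have "(t + s) * x \<le> 0" using t s0 by (intro mult_nonneg_nonpos) auto
        then show ?thesis using False tc unfolding slack by (simp add: algebra_simps)
      qed
    qed auto
    then have "2 * \<tau> * I \<le> 2 * \<tau> * ((t - s) * \<kappa>)" using \<tau> by (intro mult_left_mono) (auto simp: algebra_simps)
    also have "\<dots> = 2 * c * (t - s)" by (simp add: c)
    also have "\<dots> \<le> 2 * c * t" using c(2) s0 by (intro mult_left_mono) auto
    also have "\<dots> \<le> t * t / 2" using mult_right_mono[OF 1 t] by simp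
    also have "\<dots> \<le> (1 - \<tau>) * (t\<^sup>2 + c\<^sup>2)"
      using mult_right_mono[of "1 / 2" "1 - \<tau>" "t\<^sup>2 + c\<^sup>2"] \<tau> by (simp add: power2_eq_square) (smt (verit) zero_le_square)
    finally show ?thesis by (rule goal)
  next
    case 2
    \<comment> \<open>The zero of \<open>- slack\<close> on the right. The linear function on the
      half-line is negative before \<open>b\<close>, and the triangle over \<open>{0..b}\<close>
      cancels that part exactly.\<close>
    define b where "b = (t\<^sup>2 - c\<^sup>2) / (2 * (t - s))"
    have ts: "t - s > 0" using 2 sc c by simp
    have tc: "c\<^sup>2 \<le> t\<^sup>2" using 2 c by (intro power_mono) auto
    have b: "0 \<le> b" "2 * (t - s) * b = t\<^sup>2 - c\<^sup>2" using ts tc by (auto simp: b_def)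
    have "I \<le> (c\<^sup>2 - t\<^sup>2) / 2 + 2 * (t - s) * \<kappa> / 2 + \<kappa> / 4 * (0 * 0\<^sup>2 + 2 * (t - s) * b\<^sup>2)"
    proof (rule v)
      fix x
      show "max 0 (- slack \<tau> t x) \<le> indicator {0..} x * ((c\<^sup>2 - t\<^sup>2) + 2 * (t - s) * x)
        + indicator {- 0..0} x * (0 * (x + 0)) + indicator {0..b} x * (2 * (t - s) * (b - x))"
      proof (cases "x \<ge> 0")
        case True
        have "2 * (t - s) * (b - x) = t\<^sup>2 - c\<^sup>2 - 2 * (t - s) * x"
          unfolding b(2)[symmetric] by (simp add: algebra_simps)
        moreover have "x \<le> b \<Longrightarrow> 0 \<le> 2 * (t - s) * (b - x)" "b \<le> x \<Longrightarrow> 2 * (t - s) * (b - x) \<le> 0"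
          using ts by (auto intro: mult_nonneg_nonpos)
        ultimately show ?thesis using True unfolding slack
          by (cases "x \<le> b") (auto simp: algebra_simps indicator_def)
      next
        case False
        then have "(t + s) * x \<le> 0" using t s0 by (intro mult_nonneg_nonpos) auto
        then show ?thesis using False tc unfolding slack by (simp add: algebra_simps)
      qed
    qed (use ts b in auto)
    then have "2 * \<tau> * I \<le> 2 * \<tau> * ((c\<^sup>2 - t\<^sup>2) / 2 + 2 * (t - s) * \<kappa> / 2 + \<kappa> / 4 * (2 * (t - s) * b\<^sup>2))"
      using \<tau> by (intro mult_left_mono) auto
    also have "\<dots> = (1 - \<tau>) * (t\<^sup>2 + c\<^sup>2) - (t - c)\<^sup>2 + c * (t\<^sup>2 - c\<^sup>2)\<^sup>2 / (4 * (t - s))"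
      unfolding main[symmetric] b_def sq[symmetric, OF less_imp_neq[OF ts, symmetric]] by (simp add: algebra_simps)
    also have "c * (t\<^sup>2 - c\<^sup>2)\<^sup>2 / (4 * (t - s)) \<le> (t - c)\<^sup>2"
    proof -
      have "c * (t + c)\<^sup>2 \<le> c * ((5 * c) * (t + c))"
        unfolding power2_eq_square using 2 c t by (intro mult_left_mono mult_right_mono) auto
      also have "\<dots> = 5 * c\<^sup>2 * (t + c)" by (simp add: power2_eq_square)
      also have "\<dots> \<le> 5 / 6 * (t + c)" using c6 c t by (intro mult_right_mono) auto
      also have "\<dots> \<le> 4 * (t - s)" using 2 sc c by simp
      finally have "(t - c)\<^sup>2 * (c * (t + c)\<^sup>2) \<le> (t - c)\<^sup>2 * (4 * (t - s))"
        by (intro mult_left_mono) auto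
      moreover have "c * (t\<^sup>2 - c\<^sup>2)\<^sup>2 = (t - c)\<^sup>2 * (c * (t + c)\<^sup>2)"
        by (simp add: power2_eq_square algebra_simps)
      ultimately have fin: "c * (t\<^sup>2 - c\<^sup>2)\<^sup>2 \<le> (t - c)\<^sup>2 * (4 * (t - s))" by (simp only:)
      show ?thesis by (rule iffD2[OF pos_divide_le_eq fin]) (use ts in simp)
    qed
    finally show ?thesis by (intro goal) simp
  next
    case 3
    \<comment> \<open>Now \<open>- slack\<close> is nonnegative on the whole right half-line, and
      its zero \<open>- b\<close> lies on the left; the triangle over \<open>{- b..0}\<close>
      accounts for the left half exactly.\<close>
    define b where "b = (c\<^sup>2 - t\<^sup>2) / (2 * (t + s))"
    have ts: "t + s > 0" using t s0 by simp
    have tc: "t\<^sup>2 \<le> c\<^sup>2" using 3 t by (intro power_mono) auto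
    have b: "0 \<le> b" "2 * (t + s) * b = c\<^sup>2 - t\<^sup>2" using ts tc by (auto simp: b_def)
    have "I \<le> (c\<^sup>2 - t\<^sup>2) / 2 + 2 * (t - s) * \<kappa> / 2 + \<kappa> / 4 * (2 * (t + s) * b\<^sup>2 + 0 * 0\<^sup>2)"
    proof (rule v)
      fix x
      have e: "2 * (t + s) * (x + b) = c\<^sup>2 - t\<^sup>2 + 2 * (t + s) * x"
          unfolding b(2)[symmetric] by (simp add: algebra_simps)
      have e2: "- b \<le> x \<Longrightarrow> 0 \<le> 2 * (t + s) * (x + b)" "x < - b \<Longrightarrow> 2 * (t + s) * (x + b) \<le> 0"
          using ts by (auto intro: mult_nonneg_nonpos)
      show "max 0 (- slack \<tau> t x) \<le> indicator {0..} x * ((c\<^sup>2 - t\<^sup>2) + 2 * (t - s) * x)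
        + indicator {- b..0} x * (2 * (t + s) * (x + b)) + indicator {0..0} x * (0 * (0 - x))"
      proof (cases "x \<ge> 0")
        case True
        then have "0 \<le> (t - s) * x" using 3 by (intro mult_nonneg_nonneg) auto
        then show ?thesis using True tc e e2 b unfolding slack
          by (auto simp: algebra_simps indicator_def)
      next
        case False
        then show ?thesis using e e2 unfolding slack
          by (cases "- b \<le> x") (auto simp: algebra_simps indicator_def)
      qed
    qed (use ts b in auto)
    then have "2 * \<tau> * I \<le> 2 * \<tau> * ((c\<^sup>2 - t\<^sup>2) / 2 + 2 * (t - s) * \<kappa> / 2 + \<kappa> / 4 * (2 * (t + s) * b\<^sup>2))"
      using \<tau> by (intro mult_left_mono) auto
    also have "\<dots> = (1 - \<tau>) * (t\<^sup>2 + c\<^sup>2) - (t - c)\<^sup>2 + c * (c\<^sup>2 - t\<^sup>2)\<^sup>2 / (4 * (t + s))"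
      unfolding main[symmetric] b_def sq[symmetric, OF less_imp_neq[OF ts, symmetric]] by (simp add: algebra_simps)
    also have "c * (c\<^sup>2 - t\<^sup>2)\<^sup>2 / (4 * (t + s)) \<le> (t - c)\<^sup>2"
    proof -
      have "c * (t + c)\<^sup>2 \<le> c * (2 * c)\<^sup>2"
        using 3 c t by (intro mult_left_mono power_mono) auto
      also have "\<dots> = 4 * c * c\<^sup>2" by (simp add: power2_eq_square)
      also have "\<dots> \<le> 4 * c * \<tau>" using c3 c \<tau> by (intro mult_left_mono) auto
      also have "\<dots> \<le> 4 * (t + s)" using t by (simp add: s_def mult.commute)
      finally have "(t - c)\<^sup>2 * (c * (t + c)\<^sup>2) \<le> (t - c)\<^sup>2 * (4 * (t + s))"
        by (intro mult_left_mono) auto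
      moreover have "c * (c\<^sup>2 - t\<^sup>2)\<^sup>2 = (t - c)\<^sup>2 * (c * (t + c)\<^sup>2)"
        by (simp add: power2_eq_square algebra_simps)
      ultimately have fin: "c * (c\<^sup>2 - t\<^sup>2)\<^sup>2 \<le> (t - c)\<^sup>2 * (4 * (t + s))" by (simp only:)
      show ?thesis by (rule iffD2[OF pos_divide_le_eq fin]) (use ts in simp)
    qed
    finally show ?thesis by (intro goal) simp
  next
    case 4
    define b where "b = (c\<^sup>2 - t\<^sup>2) / (2 * (t + s))"
    have ts: "t + s > 0" using t s0 by simp
    have tc: "t\<^sup>2 \<le> c\<^sup>2" using 4 t c sc by (intro power_mono) auto
    have b: "0 \<le> b" "2 * (t + s) * b = c\<^sup>2 - t\<^sup>2" using ts tc by (auto simp: b_def)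
    \<comment> \<open>For t slightly below \<open>s\<close> the right piece decreases so slowly that
      its zero runs off to infinity and a triangle there would be useless. It is bounded by its
      value at 0 on the entire half-line instead.\<close>
    have "I \<le> (c\<^sup>2 - t\<^sup>2) / 2 + 0 * \<kappa> / 2 + \<kappa> / 4 * (2 * (t + s) * b\<^sup>2 + 0 * 0\<^sup>2)"
    proof (rule v)
      fix x
      have e: "2 * (t + s) * (x + b) = c\<^sup>2 - t\<^sup>2 + 2 * (t + s) * x"
          unfolding b(2)[symmetric] by (simp add: algebra_simps)
      have e2: "- b \<le> x \<Longrightarrow> 0 \<le> 2 * (t + s) * (x + b)" "x < - b \<Longrightarrow> 2 * (t + s) * (x + b) \<le> 0"
          using ts by (auto intro: mult_nonneg_nonpos)
      show "max 0 (- slack \<tau> t x) \<le> indicator {0..} x * ((c\<^sup>2 - t\<^sup>2) + 0 * x)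
        + indicator {- b..0} x * (2 * (t + s) * (x + b)) + indicator {0..0} x * (0 * (0 - x))"
      proof (cases "x \<ge> 0")
        case True
        have "t * x \<le> s * x" using 4 True by (intro mult_right_mono) auto
        then have "- slack \<tau> t x \<le> c\<^sup>2 - t\<^sup>2" using True unfolding slack by simp
        then show ?thesis using True tc e2 b by (auto simp: indicator_def)
      next
        case False
        then show ?thesis using e e2 unfolding slack
          by (cases "- b \<le> x") (auto simp: algebra_simps indicator_def)
      qed
    qed (use ts b in auto)
    then have "2 * \<tau> * I \<le> 2 * \<tau> * ((c\<^sup>2 - t\<^sup>2) / 2 + \<kappa> / 4 * (2 * (t + s) * b\<^sup>2))"
      using \<tau> by (intro mult_left_mono) auto
    also have "\<dots> = \<tau> * (c\<^sup>2 - t\<^sup>2) + c * (c\<^sup>2 - t\<^sup>2)\<^sup>2 / (4 * (t + s))"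
      unfolding b_def sq[symmetric, OF less_imp_neq[OF ts, symmetric]] by (simp add: algebra_simps diff_divide_distrib)
    also have "c * (c\<^sup>2 - t\<^sup>2)\<^sup>2 / (4 * (t + s)) \<le> c\<^sup>2 * \<tau> / 9"
    proof -
      have "c * (c\<^sup>2 - t\<^sup>2)\<^sup>2 \<le> c * (c\<^sup>2)\<^sup>2" using c tc by (intro mult_left_mono power_mono) auto
      also have "\<dots> \<le> c * (c\<^sup>2 * (2 / 3 * \<tau>\<^sup>2))"
        unfolding power2_eq_square[of "c\<^sup>2"] using c c2 by (intro mult_left_mono) auto
      also have "\<dots> = c\<^sup>2 * \<tau> / 9 * (4 * (s / 2 + s))" by (simp add: s_def power2_eq_square)
      also have "\<dots> \<le> c\<^sup>2 * \<tau> / 9 * (4 * (t + s))" using 4 \<tau> by (intro mult_left_mono) auto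
      finally show ?thesis using ts by (subst pos_divide_le_eq) auto
    qed
    \<comment> \<open>Collecting terms leaves \<open>c^2 * (19 / 9 * \<tau> - 1) <= t^2\<close>, and
      \<open>t >= s / 2\<close> supplies \<open>c^2 * \<tau>^2 / 4\<close>. This is the tight spot:
      at \<open>\<tau> = 1 / 2\<close> the factors are 1/18 and 1/16. The square of
      \<open>1 / 2 - \<tau>\<close> is the tangent bound for \<open>\<tau>^2\<close> at that end
      point.\<close>
    also have "\<tau> * (c\<^sup>2 - t\<^sup>2) + c\<^sup>2 * \<tau> / 9 \<le> (1 - \<tau>) * (t\<^sup>2 + c\<^sup>2)"
    proof -
      have "(s / 2)\<^sup>2 \<le> t\<^sup>2" using 4 s0 by (intro power_mono) auto
      then have "c\<^sup>2 * (\<tau>\<^sup>2 / 4) \<le> t\<^sup>2" by (simp add: s_def power_mult_distrib power_divide mult.commute)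
      moreover have "0 \<le> (1 / 2 - \<tau>) * (1 / 2 - \<tau>)" by simp
      then have "19 / 9 * \<tau> - 1 \<le> \<tau>\<^sup>2 / 4" using \<tau> by (simp add: power2_eq_square algebra_simps)
      then have "c\<^sup>2 * (19 / 9 * \<tau> - 1) \<le> c\<^sup>2 * (\<tau>\<^sup>2 / 4)" by (intro mult_left_mono) auto
      ultimately show ?thesis by (simp add: algebra_simps)
    qed
    finally show ?thesis by (intro goal) simp
  next
    case 5
    define b where "b = (c\<^sup>2 - t\<^sup>2) / (2 * (t + s))"
    define g where "g = (c\<^sup>2 - t\<^sup>2) / (2 * (s - t))"
    have ts: "t + s > 0" "s - t > 0" using 5 t s0 by auto
    have tc: "t\<^sup>2 \<le> c\<^sup>2" using 5 s0 t c sc by (intro power_mono) auto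
    have b: "0 \<le> b" "2 * (t + s) * b = c\<^sup>2 - t\<^sup>2" using ts tc by (auto simp: b_def)
    have g: "0 \<le> g" "2 * (s - t) * g = c\<^sup>2 - t\<^sup>2" using ts tc by (auto simp: g_def)
    \<comment> \<open>Both slopes have the size of \<open>s\<close> or half of it, so the negative
      part of \<open>slack\<close> lives on \<open>{- b..g}\<close> and two triangles cover it
      without any half-line term.\<close>
    have "I \<le> 0 / 2 + 0 * \<kappa> / 2 + \<kappa> / 4 * (2 * (t + s) * b\<^sup>2 + 2 * (s - t) * g\<^sup>2)"
    proof (rule v)
      fix x
      have e: "2 * (t + s) * (x + b) = c\<^sup>2 - t\<^sup>2 + 2 * (t + s) * x"
          unfolding b(2)[symmetric] by (simp add: algebra_simps)
      have e2: "- b \<le> x \<Longrightarrow> 0 \<le> 2 * (t + s) * (x + b)" "x < - b \<Longrightarrow> 2 * (t + s) * (x + b) \<le> 0"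
          using ts by (auto intro: mult_nonneg_nonpos)
      have f: "2 * (s - t) * (g - x) = c\<^sup>2 - t\<^sup>2 - 2 * (s - t) * x"
          unfolding g(2)[symmetric] by (simp add: algebra_simps)
      have f2: "x \<le> g \<Longrightarrow> 0 \<le> 2 * (s - t) * (g - x)" "g < x \<Longrightarrow> 2 * (s - t) * (g - x) \<le> 0"
          using ts by (auto intro: mult_nonneg_nonpos)
      show "max 0 (- slack \<tau> t x) \<le> indicator {0..} x * (0 + 0 * x)
        + indicator {- b..0} x * (2 * (t + s) * (x + b)) + indicator {0..g} x * (2 * (s - t) * (g - x))"
      proof (cases "x \<ge> 0")
        case True
        then show ?thesis using tc e e2 b f f2 unfolding slack
          by (cases "x \<le> g") (auto simp: algebra_simps indicator_def)
      next
        case False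
        then show ?thesis using e e2 unfolding slack
          by (cases "- b \<le> x") (auto simp: algebra_simps indicator_def)
      qed
    qed (use ts b g in auto)
    then have "2 * \<tau> * I \<le> 2 * \<tau> * (\<kappa> / 4 * (2 * (t + s) * b\<^sup>2) + \<kappa> / 4 * (2 * (s - t) * g\<^sup>2))"
      using \<tau> by (intro mult_left_mono) (auto simp: algebra_simps)
    also have "\<dots> = c * (c\<^sup>2 - t\<^sup>2)\<^sup>2 / (4 * (t + s)) + c * (c\<^sup>2 - t\<^sup>2)\<^sup>2 / (4 * (s - t))"
      unfolding b_def g_def sq[symmetric, OF less_imp_neq[OF ts(1), symmetric]]
        sq[symmetric, OF less_imp_neq[OF ts(2), symmetric]] by (simp add: algebra_simps)
    also have "\<dots> \<le> c\<^sup>2 * \<tau> / 3 + c\<^sup>2 * \<tau> / 3"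
    proof -
      have "c * (c\<^sup>2 - t\<^sup>2)\<^sup>2 \<le> c * (c\<^sup>2)\<^sup>2" using c tc by (intro mult_left_mono power_mono) auto
      also have "\<dots> \<le> c * (c\<^sup>2 * (2 / 3 * \<tau>\<^sup>2))"
        unfolding power2_eq_square[of "c\<^sup>2"] using c c2 by (intro mult_left_mono) auto
      also have "\<dots> = c\<^sup>2 * \<tau> / 3 * (4 * (s / 2))" by (simp add: s_def power2_eq_square)
      finally have *: "c * (c\<^sup>2 - t\<^sup>2)\<^sup>2 \<le> c\<^sup>2 * \<tau> / 3 * (4 * (s / 2))" .
      have bound: "c * (c\<^sup>2 - t\<^sup>2)\<^sup>2 / (4 * d) \<le> c\<^sup>2 * \<tau> / 3" if "s / 2 \<le> d" for d
      proof -
        have "c\<^sup>2 * \<tau> / 3 * (4 * (s / 2)) \<le> c\<^sup>2 * \<tau> / 3 * (4 * d)"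
          using that \<tau> by (intro mult_left_mono) auto
        with * have "c * (c\<^sup>2 - t\<^sup>2)\<^sup>2 \<le> c\<^sup>2 * \<tau> / 3 * (4 * d)" by (rule order_trans)
        then show ?thesis using that s0 by (subst pos_divide_le_eq) auto
      qed
      show ?thesis by (intro add_mono bound) (use 5 t s0 in auto)
    qed
    also have "\<dots> \<le> (1 - \<tau>) * (t\<^sup>2 + c\<^sup>2)"
    proof -
      have "2 / 3 * \<tau> * c\<^sup>2 \<le> (1 - \<tau>) * c\<^sup>2" using \<tau> by (intro mult_right_mono) auto
      moreover have "0 \<le> (1 - \<tau>) * t\<^sup>2" using \<tau> by simp
      ultimately show ?thesis by (simp add: algebra_simps)
    qed
    finally show ?thesis by (rule goal)
  qed
qed

lemma borel_measurable_slack [measurable]: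
  assumes [measurable]: "f \<in> borel_measurable M" "g \<in> borel_measurable M"
  shows "(\<lambda>x. slack \<tau> (f x) (g x)) \<in> borel_measurable M"
  unfolding slack_def by measurable

lemma has_bochner_integral_slack:
  "has_bochner_integral lborel (\<lambda>x. slack \<tau> t x * std_normal_density x) (t\<^sup>2 + (opt_score \<tau>)\<^sup>2)"
proof -
  define c where "c = opt_score \<tau>"
  have hb: "has_bochner_integral lborel (\<lambda>x. 2 * \<tau> * c * (std_normal_density x * \<bar>x\<bar>)
      + (t\<^sup>2 - c\<^sup>2) * std_normal_density x + (- 2 * t) * (std_normal_density x * x))
     (2 * \<tau> * c * sqrt (2 / pi) + (t\<^sup>2 - c\<^sup>2) * 1 + (- 2 * t) * 0)"
    by (intro has_bochner_integral_add has_bochner_integral_mult_right has_bochner_integral_std_normal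
        has_bochner_integral_std_normal_abs has_bochner_integral_std_normal_id)
  have fe: "2 * \<tau> * c * (std_normal_density x * \<bar>x\<bar>)
      + (t\<^sup>2 - c\<^sup>2) * std_normal_density x + (- 2 * t) * (std_normal_density x * x)
      = slack \<tau> t x * std_normal_density x" for x
    by (simp add: slack_def c_def algebra_simps)
  have sq: "sqrt (2 / pi) * sqrt (2 / pi) = 2 / pi" by simp
  have ve: "2 * \<tau> * c * sqrt (2 / pi) + (t\<^sup>2 - c\<^sup>2) * 1 + (- 2 * t) * 0 = t\<^sup>2 + c\<^sup>2"
    using arg_cong[OF sq, of "\<lambda>k. 2 * \<tau> * \<tau> * k"]
    by (simp add: c_def opt_score_def power2_eq_square ac_simps del: real_sqrt_mult_self)
  show ?thesis using hb unfolding fe ve by (simp only: c_def)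
qed

section \<open>The inequality for Gaussian inputs with mean \<theta>\<close>

text \<open>\<open>ennreal\<close> sends negative reals to 0, so the coercion itself takes the
  positive part. Below, \<open>ennreal (slack ...)\<close> and \<open>ennreal (- slack ...)\<close>
  therefore stand for the two parts of \<open>slack\<close>.\<close>

lemma nn_integral_gaussian_law_shift:
  fixes f :: "real \<Rightarrow> real"
  assumes [measurable]: "f \<in> borel_measurable borel"
    and int: "integrable lborel (\<lambda>y. max 0 (f y) * std_normal_density y)"
  shows "(\<integral>\<^sup>+x. ennreal (f (x - \<theta>)) \<partial>gaussian_law \<theta>)
    = ennreal (\<integral>y. max 0 (f y) * std_normal_density y \<partial>lborel)"
proof -
  have "(\<integral>\<^sup>+x. ennreal (f (x - \<theta>)) \<partial>gaussian_law \<theta>)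
      = (\<integral>\<^sup>+x. ennreal (normal_density \<theta> 1 x) * ennreal (f (x - \<theta>)) \<partial>lborel)"
    unfolding gaussian_law_def by (intro nn_integral_density) auto
  also have "\<dots> = (\<integral>\<^sup>+y. ennreal (std_normal_density y) * ennreal (f y) \<partial>lborel)"
    by (subst nn_integral_real_affine[where c=1 and t=\<theta>]) (auto simp: normal_density_def)
  also have "\<dots> = (\<integral>\<^sup>+y. ennreal (max 0 (f y) * std_normal_density y) \<partial>lborel)"
    by (intro nn_integral_cong)
      (simp add: ennreal_mult'' ennreal_max_0 mult.commute)
  also have "\<dots> = ennreal (\<integral>y. max 0 (f y) * std_normal_density y \<partial>lborel)"
    by (rule nn_integral_eq_integral[OF int]) auto
  finally show ?thesis .
qed

text \<open>These are the three conditions that \<open>ldp_exchange_le\<close> imposes at each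
  output, with t the score of that output. Strict positivity holds because the positive part
  integrates to at least the mean \<open>t^2 + c^2\<close>, and \<open>c > 0\<close>.\<close>

lemma slack_balance:
  fixes \<tau> \<theta> t :: real
  assumes \<tau>: "0 < \<tau>" "\<tau> \<le> 1 / 2"
  defines "pos \<equiv> \<lambda>t. \<integral>\<^sup>+x. ennreal (slack \<tau> t (x - \<theta>)) \<partial>gaussian_law \<theta>"
    and "neg \<equiv> \<lambda>t. \<integral>\<^sup>+x. ennreal (- slack \<tau> t (x - \<theta>)) \<partial>gaussian_law \<theta>"
  shows "ennreal ((1 + \<tau>) / (1 - \<tau>)) * neg t \<le> pos t" and "0 < pos t" and "pos t < \<top>"
proof -
  define P where "P = (\<integral>y. max 0 (slack \<tau> t y) * std_normal_density y \<partial>lborel)"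
  define N where "N t = (\<integral>y. max 0 (- slack \<tau> t y) * std_normal_density y \<partial>lborel)" for t
  note hs = has_bochner_integral_slack[of \<tau> t]
  have int: "integrable lborel (\<lambda>x. slack \<tau> t x * std_normal_density x)"
    using hs by (rule integrable.intros)
  have intP: "integrable lborel (\<lambda>y. max 0 (slack \<tau> t y) * std_normal_density y)"
    by (rule Bochner_Integration.integrable_bound[OF int]) (auto intro!: AE_I2 mult_right_mono simp: abs_mult)
  have intN: "integrable lborel (\<lambda>y. max 0 (- slack \<tau> t y) * std_normal_density y)"
    by (rule Bochner_Integration.integrable_bound[OF int]) (auto intro!: AE_I2 mult_right_mono simp: abs_mult)
  have pos: "pos t = ennreal P" and neg: "neg t = ennreal (N t)"
    unfolding pos_def neg_def P_def N_def
    by (intro nn_integral_gaussian_law_shift intP intN; simp)+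
  have N0: "0 \<le> N t" unfolding N_def by (intro Bochner_Integration.integral_nonneg) auto
  have "P - N t = (\<integral>y. max 0 (slack \<tau> t y) * std_normal_density y - max 0 (- slack \<tau> t y) * std_normal_density y \<partial>lborel)"
    unfolding P_def N_def by (rule Bochner_Integration.integral_diff[symmetric, OF intP intN])
  also have "\<dots> = (\<integral>y. slack \<tau> t y * std_normal_density y \<partial>lborel)"
    by (intro Bochner_Integration.integral_cong refl) (auto simp: max_def)
  also have "\<dots> = t\<^sup>2 + (opt_score \<tau>)\<^sup>2"
    by (rule has_bochner_integral_integral_eq[OF hs])
  finally have PN: "P = N t + (t\<^sup>2 + (opt_score \<tau>)\<^sup>2)" by simp
  \<comment> \<open>\<open>slack\<close> is invariant under changing the signs of t and y together,
    and the standard normal law is symmetric.\<close>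
  have "N (- t) = N t"
    unfolding N_def
    by (subst lborel_integral_real_affine[where c="-1" and t=0]) (simp_all add: slack_def normal_density_def)
  then have "N t = N \<bar>t\<bar>" by (cases "t \<ge> 0") auto
  then have "2 * \<tau> / (1 - \<tau>) * N t \<le> t\<^sup>2 + (opt_score \<tau>)\<^sup>2"
    using integral_negative_slack_le[OF \<tau>, of "\<bar>t\<bar>"] by (simp add: N_def)
  moreover have "(1 + \<tau>) / (1 - \<tau>) = 1 + 2 * \<tau> / (1 - \<tau>)"
    using \<tau> by (simp add: field_simps)
  ultimately have "(1 + \<tau>) / (1 - \<tau>) * N t \<le> P" unfolding PN by (simp add: distrib_right)
  then show "ennreal ((1 + \<tau>) / (1 - \<tau>)) * neg t \<le> pos t"
    using \<tau> N0 unfolding pos neg by (simp add: ennreal_mult[symmetric] ennreal_leI)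
  have "0 < P" unfolding PN using \<tau> N0
    by (intro add_nonneg_pos) (auto simp: opt_score_def intro!: add_nonneg_pos)
  then show "0 < pos t" "pos t < \<top>" unfolding pos by auto
qed

subsection \<open>Private mechanisms\<close>

text \<open>The set-wise privacy bound is an inequality between the measures \<open>Q x\<close> and
  a multiple of \<open>Q x'\<close>, so it passes to integrals by monotonicity in the
  measure.\<close>

lemma ldp_nn_integral_le:
  assumes Q: "Q \<in> ldp_mechanisms \<epsilon> Z" and f: "f \<in> borel_measurable Z"
  shows "(\<integral>\<^sup>+z. f z \<partial>Q x) \<le> ennreal (exp \<epsilon>) * (\<integral>\<^sup>+z. f z \<partial>Q x')"
proof -
  have Qm: "Q \<in> borel \<rightarrow>\<^sub>M prob_algebra Z"
    and ldp: "\<And>A. A \<in> sets Z \<Longrightarrow> measure (Q x) A \<le> exp \<epsilon> * measure (Q x') A"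
    using Q by (auto simp: ldp_mechanisms_def)
  interpret Qp: prob_space "Q y" for y by (rule kernel_facts(4)[OF Qm])
  have "emeasure (Q x) A \<le> ennreal (exp \<epsilon>) * emeasure (Q x') A" for A
  proof (cases "A \<in> sets Z")
    case True
    show ?thesis
      unfolding Qp.emeasure_eq_measure ennreal_mult[symmetric, OF exp_ge_zero measure_nonneg]
      by (rule ennreal_leI[OF ldp[OF True]])
  next
    \<comment> \<open>\<open>le_measure\<close> compares \<open>emeasure\<close> as a function on
      all sets, including those outside the sigma-algebra, where it is 0.\<close>
    case False
    then have "emeasure (Q x) A = 0" by (simp add: emeasure_notin_sets kernel_facts(2)[OF Qm])
    then show ?thesis by simp
  qed
  then have le: "Q x \<le> scale_measure (ennreal (exp \<epsilon>)) (Q x')"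
    by (subst le_measure) (simp_all add: kernel_facts(2)[OF Qm])
  have "(\<integral>\<^sup>+z. f z \<partial>Q x) \<le> (\<integral>\<^sup>+z. f z \<partial>scale_measure (ennreal (exp \<epsilon>)) (Q x'))"
    by (rule nn_integral_mono_measure[OF _ le]) (simp add: kernel_facts(2)[OF Qm])
  also have "\<dots> = ennreal (exp \<epsilon>) * (\<integral>\<^sup>+z. f z \<partial>Q x')"
    using f by (intro nn_integral_scale_measure) (simp cong: measurable_cong_sets add: kernel_facts(2)[OF Qm])
  finally show ?thesis .
qed

text \<open>No versions of densities of \<open>Q x\<close> are needed: multiplying \<open>m z x\<close> by
  \<open>\<integral>\<^sup>+y. p z y \<partial>G / P z = 1\<close> brings in a second input \<open>y\<close>, and privacy is applied to replace
  \<open>Q x\<close> by \<open>Q y\<close> before integrating over \<open>x\<close>.\<close>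

lemma ldp_exchange_le:
  fixes m p :: "'z \<Rightarrow> real \<Rightarrow> ennreal"
  assumes Q: "Q \<in> ldp_mechanisms \<epsilon> Z" and G: "prob_space G" "sets G = sets borel"
    and m[measurable]: "(\<lambda>(z, x). m z x) \<in> borel_measurable (Z \<Otimes>\<^sub>M borel)"
    and p[measurable]: "(\<lambda>(z, x). p z x) \<in> borel_measurable (Z \<Otimes>\<^sub>M borel)"
    and balance: "\<And>z. z \<in> space Z \<Longrightarrow> ennreal (exp \<epsilon>) * (\<integral>\<^sup>+x. m z x \<partial>G) \<le> (\<integral>\<^sup>+x. p z x \<partial>G)"
    and pos: "\<And>z. z \<in> space Z \<Longrightarrow> 0 < (\<integral>\<^sup>+x. p z x \<partial>G)"
    and fin: "\<And>z. z \<in> space Z \<Longrightarrow> (\<integral>\<^sup>+x. p z x \<partial>G) < \<top>"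
  shows "(\<integral>\<^sup>+x. \<integral>\<^sup>+z. m z x \<partial>Q x \<partial>G) \<le> (\<integral>\<^sup>+x. \<integral>\<^sup>+z. p z x \<partial>Q x \<partial>G)"
proof -
  have Qm: "Q \<in> borel \<rightarrow>\<^sub>M prob_algebra Z" using Q by (auto simp: ldp_mechanisms_def)
  note Qs[measurable] = kernel_facts(1)[OF Qm]
  note [measurable_cong] = kernel_facts(2)[OF Qm] G(2)
  note sp = kernel_facts(3)[OF Qm]
  interpret Qp: prob_space "Q x" for x by (rule kernel_facts(4)[OF Qm])
  interpret G: prob_space G by (rule G(1))
  interpret GG: pair_prob_space G G ..
  interpret QG: pair_prob_space "Q x" G for x ..
  define M where "M z = (\<integral>\<^sup>+x. m z x \<partial>G)" for z
  define P where "P z = (\<integral>\<^sup>+x. p z x \<partial>G)" for z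
  define E where "E = ennreal (exp \<epsilon>)"
  have mG: "(\<lambda>(z, x). m z x) \<in> borel_measurable (Z \<Otimes>\<^sub>M G)" "(\<lambda>(z, x). p z x) \<in> borel_measurable (Z \<Otimes>\<^sub>M G)"
    by measurable
  have M[measurable]: "M \<in> borel_measurable Z" and P[measurable]: "P \<in> borel_measurable Z"
    unfolding M_def P_def using mG by (auto intro!: G.borel_measurable_nn_integral)
  have spG: "space G = UNIV" using sets_eq_imp_space_eq[OF G(2)] by simp
  have mx[measurable]: "m z \<in> borel_measurable borel" "p z \<in> borel_measurable borel" if "z \<in> space Z" for z
    using measurable_compose[OF measurable_Pair1'[OF that] m] measurable_compose[OF measurable_Pair1'[OF that] p] by simp_all
  have mz[measurable]: "(\<lambda>z. m z x) \<in> borel_measurable Z" "(\<lambda>z. p z x) \<in> borel_measurable Z" for x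
    using measurable_compose[OF measurable_Pair2' m, of x] measurable_compose[OF measurable_Pair2' p, of x] by simp_all
  \<comment> \<open>A transport plan at output z from the mass of \<open>m z\<close> to that of
    \<open>p z\<close>, proportional to the product. Its y-integral gives back \<open>m z x\<close>
    (\<open>cancel\<close>); its x-integral is \<open>p z y\<close> times the ratio of total masses,
    which \<open>balance\<close> bounds by \<open>exp (- \<epsilon>)\<close>
    (\<open>gain\<close>).\<close>
  define k where "k z x y = m z x * p z y / P z" for z x y
  have cancel: "(\<integral>\<^sup>+y. k z x y \<partial>G) = m z x" if z: "z \<in> space Z" for z x
  proof -
    have "(\<integral>\<^sup>+y. k z x y \<partial>G) = (\<integral>\<^sup>+y. m z x / P z * p z y \<partial>G)"
      by (simp add: k_def divide_ennreal_def ac_simps)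
    also have "\<dots> = m z x / P z * P z"
      unfolding P_def using mx[OF z] by (intro nn_integral_cmult) simp
    also have "\<dots> = m z x"
      using pos[OF z] fin[OF z] unfolding P_def[symmetric]
      by (simp add: ennreal_divide_times mult_divide_eq_ennreal)
    finally show ?thesis .
  qed
  have gain: "(\<integral>\<^sup>+x. E * k z x y \<partial>G) \<le> p z y" if z: "z \<in> space Z" for z y
  proof -
    have "(\<integral>\<^sup>+x. E * k z x y \<partial>G) = (\<integral>\<^sup>+x. E * p z y / P z * m z x \<partial>G)"
      by (simp add: k_def divide_ennreal_def ac_simps)
    also have "\<dots> = E * p z y / P z * M z"
      unfolding M_def using mx[OF z] by (intro nn_integral_cmult) simp
    also have "\<dots> = p z y / P z * (E * M z)"
      by (simp add: divide_ennreal_def ac_simps)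
    also have "\<dots> \<le> p z y / P z * P z"
      using balance[OF z] unfolding E_def M_def P_def by (intro mult_left_mono) auto
    also have "\<dots> = p z y"
      using pos[OF z] fin[OF z] unfolding P_def[symmetric]
      by (simp add: ennreal_divide_times mult_divide_eq_ennreal)
    finally show ?thesis .
  qed
  have kz[measurable]: "(\<lambda>z. k z x y) \<in> borel_measurable Z" for x y unfolding k_def by measurable
  have k1: "(\<lambda>(z, y). k z x y) \<in> borel_measurable (Q x \<Otimes>\<^sub>M G)" for x unfolding k_def by measurable
  have k2: "(\<lambda>(z, x). E * k z x y) \<in> borel_measurable (Q y \<Otimes>\<^sub>M G)" for y unfolding k_def by measurable
  \<comment> \<open>Exchanging x and y needs joint measurability although the integrating measure
    \<open>Q y\<close> varies with y; the pair is treated as one parameter of the kernel.\<close>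
  have k3: "(\<lambda>(x, y). \<integral>\<^sup>+z. E * k z x y \<partial>Q y) \<in> borel_measurable (G \<Otimes>\<^sub>M G)"
  proof -
    have "(\<lambda>(w, z). E * k z (fst w) (snd w)) \<in> borel_measurable ((borel \<Otimes>\<^sub>M borel) \<Otimes>\<^sub>M Z)"
      unfolding k_def by measurable
    moreover have "(\<lambda>w. Q (snd w)) \<in> (borel \<Otimes>\<^sub>M borel) \<rightarrow>\<^sub>M subprob_algebra Z" by measurable
    ultimately have "(\<lambda>w. \<integral>\<^sup>+z. E * k z (fst w) (snd w) \<partial>Q (snd w)) \<in> borel_measurable (borel \<Otimes>\<^sub>M borel)"
      by (rule nn_integral_measurable_subprob_algebra2)
    then show ?thesis by (simp add: case_prod_beta' cong: measurable_cong_sets) measurable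
  qed
  have "(\<integral>\<^sup>+x. \<integral>\<^sup>+z. m z x \<partial>Q x \<partial>G) = (\<integral>\<^sup>+x. \<integral>\<^sup>+z. \<integral>\<^sup>+y. k z x y \<partial>G \<partial>Q x \<partial>G)"
    by (intro nn_integral_cong) (simp add: cancel sp)
  also have "\<dots> = (\<integral>\<^sup>+x. \<integral>\<^sup>+y. \<integral>\<^sup>+z. k z x y \<partial>Q x \<partial>G \<partial>G)"
    by (intro nn_integral_cong QG.Fubini'[symmetric] k1)
  also have "\<dots> \<le> (\<integral>\<^sup>+x. \<integral>\<^sup>+y. \<integral>\<^sup>+z. E * k z x y \<partial>Q y \<partial>G \<partial>G)"
  proof (intro nn_integral_mono)
    fix x y
    have "(\<integral>\<^sup>+z. k z x y \<partial>Q x) \<le> E * (\<integral>\<^sup>+z. k z x y \<partial>Q y)"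
      unfolding E_def by (rule ldp_nn_integral_le[OF Q kz])
    also have "\<dots> = (\<integral>\<^sup>+z. E * k z x y \<partial>Q y)"
      by (rule nn_integral_cmult[symmetric]) measurable
    finally show "(\<integral>\<^sup>+z. k z x y \<partial>Q x) \<le> (\<integral>\<^sup>+z. E * k z x y \<partial>Q y)" .
  qed
  also have "\<dots> = (\<integral>\<^sup>+y. \<integral>\<^sup>+x. \<integral>\<^sup>+z. E * k z x y \<partial>Q y \<partial>G \<partial>G)"
    by (rule GG.Fubini'[symmetric, OF k3])
  also have "\<dots> = (\<integral>\<^sup>+y. \<integral>\<^sup>+z. \<integral>\<^sup>+x. E * k z x y \<partial>G \<partial>Q y \<partial>G)"
    by (intro nn_integral_cong QG.Fubini' k2)
  also have "\<dots> \<le> (\<integral>\<^sup>+y. \<integral>\<^sup>+z. p z y \<partial>Q y \<partial>G)"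
    by (intro nn_integral_mono gain) (simp add: sp)
  finally show ?thesis .
qed

section \<open>Joint law of output and input, and the score\<close>

lemma distr_snd_joint_law:
  assumes Qm: "Q \<in> borel \<rightarrow>\<^sub>M prob_algebra Z"
  shows "distr (joint_law Z Q \<theta>) borel snd = gaussian_law \<theta>"
proof (rule measure_eqI)
  note sJ = sets_joint_law[OF Qm, of \<theta>]
  note [measurable_cong] = sJ
  interpret Qp: prob_space "Q y" for y by (rule kernel_facts(4)[OF Qm])
  fix A assume "A \<in> sets (distr (joint_law Z Q \<theta>) borel snd)"
  then have A[measurable]: "A \<in> sets borel" by simp
  have "emeasure (distr (joint_law Z Q \<theta>) borel snd) A = (\<integral>\<^sup>+w. indicator A (snd w) \<partial>joint_law Z Q \<theta>)"
    by (subst nn_integral_distr[symmetric, of snd _ borel "indicator A"]) auto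
  also have "\<dots> = (\<integral>\<^sup>+x. \<integral>\<^sup>+z. indicator A (snd (z, x)) \<partial>Q x \<partial>gaussian_law \<theta>)"
    by (rule nn_integral_joint_law[OF Qm]) measurable
  also have "\<dots> = emeasure (gaussian_law \<theta>) A"
    by (simp add: Qp.emeasure_space_1 sets_gaussian_law)
  finally show "emeasure (distr (joint_law Z Q \<theta>) borel snd) A = emeasure (gaussian_law \<theta>) A" .
qed (simp add: sets_gaussian_law)

lemma has_bochner_integral_gaussian_law:
  fixes f :: "real \<Rightarrow> real"
  assumes [measurable]: "f \<in> borel_measurable borel"
    and f: "has_bochner_integral lborel (\<lambda>y. f y * std_normal_density y) I"
  shows "has_bochner_integral (gaussian_law \<theta>) (\<lambda>x. f (x - \<theta>)) I"
proof -
  have "has_bochner_integral lborel (\<lambda>x. f (x - \<theta>) * normal_density \<theta> 1 x) I"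
    using f by (subst lborel_has_bochner_integral_real_affine_iff[where c=1 and t=\<theta>])
      (simp_all add: normal_density_def)
  then show ?thesis
    unfolding gaussian_law_def
    by (intro has_bochner_integral_density) (auto simp: mult.commute)
qed

lemma has_bochner_integral_joint_law:
  fixes f :: "real \<Rightarrow> real"
  assumes Qm: "Q \<in> borel \<rightarrow>\<^sub>M prob_algebra Z" and [measurable]: "f \<in> borel_measurable borel"
    and f: "has_bochner_integral lborel (\<lambda>y. f y * std_normal_density y) I"
  shows "has_bochner_integral (joint_law Z Q \<theta>) (\<lambda>w. f (snd w - \<theta>)) I"
proof -
  note [measurable_cong] = sets_joint_law[OF Qm, of \<theta>]
  have "has_bochner_integral (distr (joint_law Z Q \<theta>) borel snd) (\<lambda>x. f (x - \<theta>)) I"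
    unfolding distr_snd_joint_law[OF Qm] by (rule has_bochner_integral_gaussian_law) fact+
  then show ?thesis by (simp add: has_bochner_integral_iff integrable_distr_eq integral_distr)
qed

lemma privatized_density_ge:
  assumes Qm: "Q \<in> borel \<rightarrow>\<^sub>M prob_algebra Z" and q: "kernel_density Z Q x0 q" and z: "z \<in> space Z"
    and lower: "\<And>x. l \<le> q z x"
  shows "l \<le> privatized_density q \<theta> z"
proof -
  have "l = (\<integral>x. l * normal_density \<theta> 1 x \<partial>lborel)"
    by (simp add: integral_normal_density)
  also have "\<dots> \<le> privatized_density q \<theta> z"
    unfolding privatized_density_def
    by (intro integral_mono integrable_mult_right integrable_normal_density
        kernel_density_integrable[OF Qm q z] mult_right_mono lower) auto
  finally show ?thesis .
qed

lemma kernel_density_moment_integrable: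
  assumes Qm: "Q \<in> borel \<rightarrow>\<^sub>M prob_algebra Z" and q: "kernel_density Z Q x0 q" and z: "z \<in> space Z"
  shows "integrable lborel (\<lambda>x. (x - \<theta>) * (q z x * normal_density \<theta> 1 x))"
proof -
  obtain e where e: "\<And>x. q z x > 0" "\<And>x. q z x \<le> exp e"
    using kernel_density_bounds[OF Qm q] z by metis
  have [measurable]: "q z \<in> borel_measurable borel" by (rule kernel_density_section[OF Qm q z])
  have "integrable lborel (\<lambda>x. exp e * (normal_density \<theta> 1 x * \<bar>x - \<theta>\<bar>^1))"
    by (intro integrable_mult_right integrable_normal_moment_abs) simp
  then show ?thesis
    by (rule Bochner_Integration.integrable_bound)
       (use e in \<open>auto intro!: mult_right_mono AE_I2 simp: abs_mult less_imp_le mult.commute mult.left_commute\<close>)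
qed

lemma score_eq:
  "score q \<theta> z = (\<integral>x. (x - \<theta>) * (q z x * normal_density \<theta> 1 x) \<partial>lborel) / privatized_density q \<theta> z"
  by (simp add: score_def)

text \<open>This makes \<open>slack\<close> at the score integrable under the joint law. The
  numerator of the score is at most \<open>exp e\<close> times the mean of
  \<open>\<bar>x - \<theta>\<bar>\<close>, the denominator at least
  \<open>exp (- e)\<close>.\<close>

lemma score_bounded:
  assumes Qm: "Q \<in> borel \<rightarrow>\<^sub>M prob_algebra Z" and q: "kernel_density Z Q x0 q"
  obtains B where "\<And>z. z \<in> space Z \<Longrightarrow> \<bar>score q \<theta> z\<bar> \<le> B"
proof -
  obtain e where e: "\<And>z x. z \<in> space Z \<Longrightarrow> q z x > 0" "\<And>z x. z \<in> space Z \<Longrightarrow> q z x \<le> exp e"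
    "\<And>z x. z \<in> space Z \<Longrightarrow> exp (-e) \<le> q z x"
    using kernel_density_bounds[OF Qm q] by metis
  have "\<bar>score q \<theta> z\<bar> \<le> exp e * sqrt (2 / pi) / exp (- e)" if z: "z \<in> space Z" for z
  proof -
    have abs: "has_bochner_integral lborel (\<lambda>x. exp e * (normal_density \<theta> 1 x * \<bar>x - \<theta>\<bar>)) (exp e * sqrt (2 / pi))"
      using normal_moment_abs_odd[of 1 \<theta> 0] by (intro has_bochner_integral_mult_right) simp
    have "\<bar>\<integral>x. (x - \<theta>) * (q z x * normal_density \<theta> 1 x) \<partial>lborel\<bar>
        \<le> (\<integral>x. \<bar>(x - \<theta>) * (q z x * normal_density \<theta> 1 x)\<bar> \<partial>lborel)"
      by (rule integral_abs_bound)
    also have "\<dots> \<le> (\<integral>x. exp e * (normal_density \<theta> 1 x * \<bar>x - \<theta>\<bar>) \<partial>lborel)"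
      by (rule integral_mono'[OF integrable.intros[OF abs]])
        (use e[OF z] in \<open>auto intro!: mult_right_mono simp: abs_mult less_imp_le mult.commute mult.left_commute\<close>)
    also have "\<dots> = exp e * sqrt (2 / pi)" by (rule has_bochner_integral_integral_eq[OF abs])
    finally have N: "\<bar>\<integral>x. (x - \<theta>) * (q z x * normal_density \<theta> 1 x) \<partial>lborel\<bar> \<le> exp e * sqrt (2 / pi)" .
    have D: "exp (- e) \<le> privatized_density q \<theta> z"
      by (rule privatized_density_ge[OF Qm q z e(3)[OF z]])
    have D0: "0 < privatized_density q \<theta> z" by (rule privatized_density_pos[OF Qm q z])
    show ?thesis
      unfolding score_eq abs_divide abs_of_pos[OF D0] using N D by (intro frac_le) auto
  qed
  then show thesis by (rule that)
qed

text \<open>The score is the conditional mean of the centred input given the output. Integrating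
  over x first therefore turns the cross term into twice the squared score, of which one copy
  survives.\<close>

lemma integral_joint_law_score:
  assumes Qm: "Q \<in> borel \<rightarrow>\<^sub>M prob_algebra Z" and q: "kernel_density Z Q x0 q"
    and int: "integrable (joint_law Z Q \<theta>)
      (\<lambda>w. 2 * score q \<theta> (fst w) * (snd w - \<theta>) - (score q \<theta> (fst w))\<^sup>2)"
  shows "(\<integral>w. 2 * score q \<theta> (fst w) * (snd w - \<theta>) - (score q \<theta> (fst w))\<^sup>2 \<partial>joint_law Z Q \<theta>)
    = (\<integral>z. (score q \<theta> z)\<^sup>2 * privatized_density q \<theta> z \<partial>Q x0)"
proof -
  note [measurable_cong] = kernel_facts(2)[OF Qm]
  interpret Qp: prob_space "Q y" for y by (rule kernel_facts(4)[OF Qm])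
  interpret P: pair_sigma_finite "Q x0" lborel ..
  note [measurable] = kernel_density_measurable[OF Qm q] score_measurable[OF Qm q]
  obtain e where qp: "\<And>z x. z \<in> space Z \<Longrightarrow> q z x > 0"
    using kernel_density_bounds[OF Qm q] by metis
  define f where "f w = 2 * score q \<theta> (fst w) * (snd w - \<theta>) - (score q \<theta> (fst w))\<^sup>2" for w
  define d where "d = (\<lambda>(z, x). q z x * normal_density \<theta> 1 x)"
  have J: "joint_law Z Q \<theta> = density (Q x0 \<Otimes>\<^sub>M lborel) (\<lambda>w. ennreal (d w))"
    using q by (auto simp: kernel_density_def d_def case_prod_beta')
  have f[measurable]: "f \<in> borel_measurable (Q x0 \<Otimes>\<^sub>M lborel)" unfolding f_def by measurable
  have d[measurable]: "d \<in> borel_measurable (Q x0 \<Otimes>\<^sub>M lborel)" unfolding d_def by measurable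
  have d0: "AE w in Q x0 \<Otimes>\<^sub>M lborel. 0 \<le> d w"
    by (rule AE_I2) (auto simp: d_def space_pair_measure kernel_facts(3)[OF Qm] less_imp_le[OF qp])
  have "integrable (Q x0 \<Otimes>\<^sub>M lborel) (\<lambda>w. d w *\<^sub>R f w)"
    using int unfolding J f_def[symmetric] by (subst (asm) integrable_density[OF f d d0])
  then have "(\<integral>w. f w \<partial>joint_law Z Q \<theta>) = (\<integral>z. \<integral>x. d (z, x) *\<^sub>R f (z, x) \<partial>lborel \<partial>Q x0)"
    unfolding J integral_density[OF f d d0] by (rule P.integral_fst'[symmetric])
  also have "\<dots> = (\<integral>z. (score q \<theta> z)\<^sup>2 * privatized_density q \<theta> z \<partial>Q x0)"
  proof (rule Bochner_Integration.integral_cong[OF refl])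
    fix z assume "z \<in> space (Q x0)"
    then have z: "z \<in> space Z" by (simp add: kernel_facts(3)[OF Qm])
    have "(\<integral>x. d (z, x) *\<^sub>R f (z, x) \<partial>lborel)
      = (\<integral>x. 2 * score q \<theta> z * ((x - \<theta>) * (q z x * normal_density \<theta> 1 x))
          - (score q \<theta> z)\<^sup>2 * (q z x * normal_density \<theta> 1 x) \<partial>lborel)"
      by (intro Bochner_Integration.integral_cong refl) (simp add: d_def f_def algebra_simps)
    also have "\<dots> = 2 * score q \<theta> z * (\<integral>x. (x - \<theta>) * (q z x * normal_density \<theta> 1 x) \<partial>lborel)
          - (score q \<theta> z)\<^sup>2 * privatized_density q \<theta> z"
      unfolding privatized_density_def
      using kernel_density_moment_integrable[OF Qm q z] kernel_density_integrable[OF Qm q z]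
      by (subst Bochner_Integration.integral_diff) auto
    also have "(\<integral>x. (x - \<theta>) * (q z x * normal_density \<theta> 1 x) \<partial>lborel) = score q \<theta> z * privatized_density q \<theta> z"
      using privatized_density_pos[OF Qm q z, of \<theta>] by (simp add: score_eq)
    finally show "(\<integral>x. d (z, x) *\<^sub>R f (z, x) \<partial>lborel) = (score q \<theta> z)\<^sup>2 * privatized_density q \<theta> z"
      by (simp add: power2_eq_square)
  qed
  finally show ?thesis by (simp add: f_def)
qed

lemma fisher_information_le:
  assumes Q: "Q \<in> ldp_mechanisms \<epsilon> Z" and \<epsilon>: "0 < \<epsilon>"
    and \<tau>: "0 < \<tau>" "\<tau> \<le> 1 / 2" "exp \<epsilon> = (1 + \<tau>) / (1 - \<tau>)"
  shows "fisher_information Z Q \<theta> \<le> (opt_score \<tau>)\<^sup>2"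
proof -
  have Qm: "Q \<in> borel \<rightarrow>\<^sub>M prob_algebra Z" using Q by (auto simp: ldp_mechanisms_def)
  obtain q where q: "kernel_density Z Q 0 q" using kernel_density_exists[OF Q \<epsilon>] by blast
  note sJ[measurable_cong] = sets_joint_law[OF Qm, of \<theta>]
  have spJ: "space (joint_law Z Q \<theta>) = space Z \<times> UNIV"
    using sets_eq_imp_space_eq[OF sJ] by (simp add: space_pair_measure)
  define J where "J = joint_law Z Q \<theta>"
  define T where "T = score q \<theta>"
  have T[measurable]: "T \<in> borel_measurable Z" unfolding T_def by (rule score_measurable[OF Qm q])
  obtain B where B: "\<And>z. z \<in> space Z \<Longrightarrow> \<bar>T z\<bar> \<le> B"
    using score_bounded[OF Qm q] unfolding T_def by metis
  note J = has_bochner_integral_joint_law[OF Qm, where \<theta>=\<theta>, folded J_def]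
  note [measurable_cong] = sJ[folded J_def]
  \<comment> \<open>At t = 0 \<open>slack\<close> is the dual certificate itself.\<close>
  have int0: "has_bochner_integral J (\<lambda>w. slack \<tau> 0 (snd w - \<theta>)) ((opt_score \<tau>)\<^sup>2)"
    using J[OF _ has_bochner_integral_slack, of \<tau> 0] by simp
  have abs: "integrable J (\<lambda>w. \<bar>snd w - \<theta>\<bar>)"
    using J[of abs, OF _ has_bochner_integral_std_normal_abs[unfolded mult.commute[of "normal_density _ _ _"]]]
    by (intro integrable.intros) simp
  have one: "integrable J (\<lambda>w. 1 :: real)"
    using J[of "\<lambda>_. 1" 1] has_bochner_integral_std_normal by (intro integrable.intros) simp
  have int1: "integrable J (\<lambda>w. 2 * T (fst w) * (snd w - \<theta>) - (T (fst w))\<^sup>2)"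
  proof (rule Bochner_Integration.integrable_bound)
    show "integrable J (\<lambda>w. 2 * B * \<bar>snd w - \<theta>\<bar> + B\<^sup>2 * 1)"
      by (intro Bochner_Integration.integrable_add integrable_mult_right abs one)
    show "AE w in J. norm (2 * T (fst w) * (snd w - \<theta>) - (T (fst w))\<^sup>2) \<le> norm (2 * B * \<bar>snd w - \<theta>\<bar> + B\<^sup>2 * 1)"
    proof (rule AE_I2)
      fix w assume "w \<in> space J"
      then have b: "\<bar>T (fst w)\<bar> \<le> B" by (auto simp: J_def spJ B)
      then have B0: "0 \<le> B" by linarith
      have "\<bar>2 * T (fst w) * (snd w - \<theta>) - (T (fst w))\<^sup>2\<bar> \<le> 2 * (\<bar>T (fst w)\<bar> * \<bar>snd w - \<theta>\<bar>) + \<bar>T (fst w)\<bar>\<^sup>2"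
        by (rule order_trans[OF abs_triangle_ineq4]) (simp add: abs_mult)
      also have "\<dots> \<le> 2 * (B * \<bar>snd w - \<theta>\<bar>) + B\<^sup>2"
        using b by (intro add_mono mult_left_mono mult_right_mono power_mono) auto
      finally show "norm (2 * T (fst w) * (snd w - \<theta>) - (T (fst w))\<^sup>2) \<le> norm (2 * B * \<bar>snd w - \<theta>\<bar> + B\<^sup>2 * 1)"
        using B0 by simp
    qed
  qed measurable
  have split: "slack \<tau> (T (fst w)) (snd w - \<theta>)
      = slack \<tau> 0 (snd w - \<theta>) - (2 * T (fst w) * (snd w - \<theta>) - (T (fst w))\<^sup>2)" for w
    by (simp add: slack_def)
  have int: "integrable J (\<lambda>w. slack \<tau> (T (fst w)) (snd w - \<theta>))"
    unfolding split by (intro Bochner_Integration.integrable_diff int1 integrable.intros[OF int0])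
  have sub: "(\<integral>\<^sup>+w. ennreal (- slack \<tau> (T (fst w)) (snd w - \<theta>)) \<partial>J)
      \<le> (\<integral>\<^sup>+w. ennreal (slack \<tau> (T (fst w)) (snd w - \<theta>)) \<partial>J)"
  proof -
    have "(\<integral>\<^sup>+x. \<integral>\<^sup>+z. ennreal (- slack \<tau> (T z) (x - \<theta>)) \<partial>Q x \<partial>gaussian_law \<theta>)
        \<le> (\<integral>\<^sup>+x. \<integral>\<^sup>+z. ennreal (slack \<tau> (T z) (x - \<theta>)) \<partial>Q x \<partial>gaussian_law \<theta>)"
      by (rule ldp_exchange_le[OF Q prob_space_gaussian_law sets_gaussian_law])
        (use slack_balance[OF \<tau>(1,2)] in \<open>simp_all add: \<tau>(3)\<close>)
    then show ?thesis
      unfolding J_def by (subst (1 2) nn_integral_joint_law[OF Qm]) simp_all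
  qed
  \<comment> \<open>Finiteness matters in passing from \<open>sub\<close> to real integrals:
    \<open>enn2real\<close> sends infinity to 0 and is monotone only below a finite bound.\<close>
  have "(\<integral>\<^sup>+w. ennreal (slack \<tau> (T (fst w)) (snd w - \<theta>)) \<partial>J) < \<top>"
    using int by (simp add: real_integrable_def less_top)
  then have "0 \<le> (\<integral>w. slack \<tau> (T (fst w)) (snd w - \<theta>) \<partial>J)"
    unfolding real_lebesgue_integral_def[OF int] using sub by (simp add: enn2real_mono)
  also have "\<dots> = (opt_score \<tau>)\<^sup>2 - (\<integral>w. 2 * T (fst w) * (snd w - \<theta>) - (T (fst w))\<^sup>2 \<partial>J)"
    unfolding split Bochner_Integration.integral_diff[OF integrable.intros[OF int0] int1]
    by (simp only: has_bochner_integral_integral_eq[OF int0])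
  also have "(\<integral>w. 2 * T (fst w) * (snd w - \<theta>) - (T (fst w))\<^sup>2 \<partial>J) = fisher_information Z Q \<theta>"
    using integral_joint_law_score[OF Qm q int1[unfolded J_def T_def]]
    unfolding fisher_information_eq[OF Q q] J_def T_def .
  finally show ?thesis by simp
qed

subsection \<open>The sign mechanism\<close>

text \<open>For an explicit mechanism the density is known input by input; Tonelli's theorem
  assembles these into a density of the joint law.\<close>

lemma kernel_densityI:
  assumes Qm: "Q \<in> borel \<rightarrow>\<^sub>M prob_algebra Z"
    and q[measurable]: "(\<lambda>(z, x). q z x) \<in> borel_measurable (Z \<Otimes>\<^sub>M borel)"
    and e: "0 < e" "\<And>z x. z \<in> space Z \<Longrightarrow> q z x \<in> {exp (- e)..exp e}"
    and dens: "\<And>x. Q x = density (Q x0) (\<lambda>z. ennreal (q z x))"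
  shows "kernel_density Z Q x0 q"
proof -
  note [measurable_cong] = kernel_facts(2)[OF Qm]
  note sp = kernel_facts(3)[OF Qm]
  interpret Qp: prob_space "Q y" for y by (rule kernel_facts(4)[OF Qm])
  interpret P: pair_sigma_finite "Q x0" lborel ..
  have q0: "0 \<le> q z x" if "z \<in> space Z" for z x
    using e(2)[OF that, of x] by (auto intro: order_trans[OF exp_ge_zero])
  have "joint_law Z Q \<theta> = density (Q x0 \<Otimes>\<^sub>M lborel) (\<lambda>(z, x). ennreal (q z x * normal_density \<theta> 1 x))" for \<theta>
  proof (rule measure_eqI)
    show "sets (joint_law Z Q \<theta>) = sets (density (Q x0 \<Otimes>\<^sub>M lborel) (\<lambda>(z, x). ennreal (q z x * normal_density \<theta> 1 x)))"
      by (simp add: sets_joint_law[OF Qm] kernel_facts(2)[OF Qm] cong: sets_pair_measure_cong)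
    fix C assume "C \<in> sets (joint_law Z Q \<theta>)"
    then have C[measurable]: "C \<in> sets (Z \<Otimes>\<^sub>M borel)" by (simp add: sets_joint_law[OF Qm])
    have qx[measurable]: "(\<lambda>z. q z x) \<in> borel_measurable Z" for x
      using measurable_compose[OF measurable_Pair2' q, of x] by simp
    have Cx[measurable]: "(\<lambda>z. indicator C (z, x) :: ennreal) \<in> borel_measurable Z" for x by measurable
    have inner: "ennreal (normal_density \<theta> 1 x) * (\<integral>\<^sup>+z. indicator C (z, x) \<partial>Q x)
        = (\<integral>\<^sup>+z. ennreal (q z x * normal_density \<theta> 1 x) * indicator C (z, x) \<partial>Q x0)" for x
    proof -
      have "(\<integral>\<^sup>+z. indicator C (z, x) \<partial>Q x) = (\<integral>\<^sup>+z. ennreal (q z x) * indicator C (z, x) \<partial>Q x0)"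
        by (subst dens) (rule nn_integral_density, measurable)
      then show ?thesis
        by (simp add: nn_integral_cmult[symmetric])
          (intro nn_integral_cong, simp add: ennreal_mult q0 sp ac_simps)
    qed
    have qC: "(\<lambda>w. (case w of (z, x) \<Rightarrow> ennreal (q z x * normal_density \<theta> 1 x)) * indicator C w)
        \<in> borel_measurable (Q x0 \<Otimes>\<^sub>M lborel)" by measurable
    have "emeasure (joint_law Z Q \<theta>) C = (\<integral>\<^sup>+w. indicator C w \<partial>joint_law Z Q \<theta>)"
      by (simp add: sets_joint_law[OF Qm] C)
    also have "\<dots> = (\<integral>\<^sup>+x. \<integral>\<^sup>+z. indicator C (z, x) \<partial>Q x \<partial>gaussian_law \<theta>)"
      by (rule nn_integral_joint_law[OF Qm]) simp
    also have "\<dots> = (\<integral>\<^sup>+x. ennreal (normal_density \<theta> 1 x) * (\<integral>\<^sup>+z. indicator C (z, x) \<partial>Q x) \<partial>lborel)"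
      unfolding gaussian_law_def
    proof (rule nn_integral_density)
      show "(\<lambda>x. \<integral>\<^sup>+z. indicator C (z, x) \<partial>Q x) \<in> borel_measurable lborel"
        using nn_integral_measurable_subprob_algebra2[OF _ kernel_facts(1)[OF Qm], of "\<lambda>x z. indicator C (z, x)"]
        by simp
    qed simp
    also have "\<dots> = (\<integral>\<^sup>+w. (case w of (z, x) \<Rightarrow> ennreal (q z x * normal_density \<theta> 1 x)) * indicator C w \<partial>(Q x0 \<Otimes>\<^sub>M lborel))"
      unfolding inner using P.nn_integral_snd[OF qC] by simp
    also have "\<dots> = emeasure (density (Q x0 \<Otimes>\<^sub>M lborel) (\<lambda>(z, x). ennreal (q z x * normal_density \<theta> 1 x))) C"
      by (rule emeasure_density[symmetric]) measurable
    finally show "emeasure (joint_law Z Q \<theta>) C = \<dots>" .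
  qed
  then show ?thesis unfolding kernel_density_def using q e by blast
qed

definition sign_weight :: "real \<Rightarrow> int \<Rightarrow> real \<Rightarrow> real" where
  "sign_weight \<epsilon> z y = (if z = sign1 y then exp \<epsilon> / (1 + exp \<epsilon>) else 1 - exp \<epsilon> / (1 + exp \<epsilon>))"

lemma sign_mechanism_eq:
  "sign_mechanism \<theta> \<epsilon> x = point_measure {-1, 1} (\<lambda>z. ennreal (sign_weight \<epsilon> z (x - \<theta>)))"
  by (simp add: sign_mechanism_def sign_weight_def)

lemma sign_weight_alt:
  "sign_weight \<epsilon> z y = (if z = sign1 y then exp \<epsilon> else 1) / (1 + exp \<epsilon>)"
proof -
  have "1 + exp \<epsilon> \<noteq> (0::real)" by (metis add_pos_pos exp_gt_zero less_irrefl zero_less_one)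
  then show ?thesis by (cases "z = sign1 y") (simp_all add: sign_weight_def, simp add: field_simps)
qed

lemma sign_weight_pos: "0 < sign_weight \<epsilon> z y"
  by (simp add: sign_weight_alt add_pos_pos)

lemma sign_weight_le: "0 \<le> \<epsilon> \<Longrightarrow> sign_weight \<epsilon> z y \<le> exp \<epsilon> * sign_weight \<epsilon> z y'"
  by (auto simp: sign_weight_alt add_pos_pos divide_right_mono exp_ge_zero mult_exp_exp)

lemma sign_mechanism_ldp:
  assumes "0 \<le> \<epsilon>"
  shows "sign_mechanism \<theta> \<epsilon> \<in> ldp_mechanisms \<epsilon> sign_space"
proof -
  have p: "prob_space (sign_mechanism \<theta> \<epsilon> x)" for x
  proof
    show "emeasure (sign_mechanism \<theta> \<epsilon> x) (space (sign_mechanism \<theta> \<epsilon> x)) = 1"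
      unfolding sign_mechanism_eq space_point_measure
      by (subst emeasure_point_measure_finite, simp, simp, subst sum_ennreal[OF less_imp_le[OF sign_weight_pos]])
        (auto simp: sign_weight_def sign1_def)
  qed
  have pa: "sign_mechanism \<theta> \<epsilon> x \<in> space (prob_algebra sign_space)" for x
    using p by (simp add: space_prob_algebra sign_space_def sign_mechanism_eq sets_point_measure)
  \<comment> \<open>As a function of the input the mechanism has only two values, so measurability
    reduces to that of a half-line. The convention that the sign of 0 is 1 puts the input \<theta>
    on the right.\<close>
  have "sign_mechanism \<theta> \<epsilon> = (\<lambda>x. if \<theta> \<le> x then sign_mechanism \<theta> \<epsilon> \<theta> else sign_mechanism \<theta> \<epsilon> (\<theta> - 1))"
    by (auto simp: sign_mechanism_eq sign_weight_def sign1_def)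
  also have "\<dots> \<in> borel \<rightarrow>\<^sub>M prob_algebra sign_space"
    by (intro measurable_If measurable_const pa) measurable
  finally have m: "sign_mechanism \<theta> \<epsilon> \<in> borel \<rightarrow>\<^sub>M prob_algebra sign_space" .
  have "measure (sign_mechanism \<theta> \<epsilon> x) A \<le> exp \<epsilon> * measure (sign_mechanism \<theta> \<epsilon> y) A"
    if A: "A \<in> sets sign_space" for x y A
  proof -
    have A': "A \<subseteq> {-1, 1}" using A by (simp add: sign_space_def)
    have eq: "measure (sign_mechanism \<theta> \<epsilon> x) A = (\<Sum>z\<in>A. sign_weight \<epsilon> z (x - \<theta>))" for x
    proof -
      have "emeasure (sign_mechanism \<theta> \<epsilon> x) A = ennreal (\<Sum>z\<in>A. sign_weight \<epsilon> z (x - \<theta>))"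
        unfolding sign_mechanism_eq using A'
        by (subst emeasure_point_measure_finite) (auto simp: sum_ennreal less_imp_le[OF sign_weight_pos])
      then show ?thesis
        by (intro measure_eq_emeasure_eq_ennreal sum_nonneg less_imp_le[OF sign_weight_pos])
    qed
    show ?thesis
      unfolding eq sum_distrib_left by (intro sum_mono sign_weight_le assms)
  qed
  with m show ?thesis by (simp add: ldp_mechanisms_def)
qed

lemma kernel_density_sign_mechanism:
  assumes \<epsilon>: "0 < \<epsilon>"
  shows "kernel_density sign_space (sign_mechanism \<theta> \<epsilon>) \<theta>
    (\<lambda>z x. sign_weight \<epsilon> z (x - \<theta>) / sign_weight \<epsilon> z 0)"
proof (rule kernel_densityI[OF _ _ \<epsilon>])
  show "sign_mechanism \<theta> \<epsilon> \<in> borel \<rightarrow>\<^sub>M prob_algebra sign_space"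
    using sign_mechanism_ldp[of \<epsilon> \<theta>] \<epsilon> by (simp add: ldp_mechanisms_def)
  have "sign_weight \<epsilon> z = (\<lambda>y. if 0 \<le> y then sign_weight \<epsilon> z 0 else sign_weight \<epsilon> z (-1))" for z
    by (auto simp: sign_weight_def sign1_def)
  then have [measurable]: "sign_weight \<epsilon> z \<in> borel_measurable borel" for z
    by (rule ssubst) measurable
  have "(\<lambda>w. sign_weight \<epsilon> (fst w) (snd w - \<theta>) / sign_weight \<epsilon> (fst w) 0)
      \<in> borel_measurable (sign_space \<Otimes>\<^sub>M borel)"
    unfolding sign_space_def by (rule measurable_pair_measure_countable1) simp_all
  then show "(\<lambda>(z, x). sign_weight \<epsilon> z (x - \<theta>) / sign_weight \<epsilon> z 0) \<in> borel_measurable (sign_space \<Otimes>\<^sub>M borel)"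
    by (simp add: case_prod_beta')
  show "sign_weight \<epsilon> z (x - \<theta>) / sign_weight \<epsilon> z 0 \<in> {exp (- \<epsilon>)..exp \<epsilon>}" for z x
    using sign_weight_le[of \<epsilon> z "x - \<theta>" 0] sign_weight_le[of \<epsilon> z 0 "x - \<theta>"] sign_weight_pos[of \<epsilon> z] \<epsilon>
    by (simp add: field_simps exp_minus)
  show "sign_mechanism \<theta> \<epsilon> x = density (sign_mechanism \<theta> \<epsilon> \<theta>)
      (\<lambda>z. ennreal (sign_weight \<epsilon> z (x - \<theta>) / sign_weight \<epsilon> z 0))" for x
    unfolding sign_mechanism_eq point_measure_def
    by (subst density_density_eq)
      (auto intro!: density_cong simp: ennreal_mult[symmetric] less_imp_le[OF sign_weight_pos]
        less_imp_neq[OF sign_weight_pos, symmetric])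
qed

text \<open>As a constant plus a multiple of a half-line indicator, the weight can be integrated by
  \<open>has_bochner_integral_half_std_normal\<close>.\<close>

lemma sign_weight_half_line:
  "sign_weight \<epsilon> 1 y = 1 / (1 + exp \<epsilon>) + (exp \<epsilon> - 1) / (1 + exp \<epsilon>) * indicator {0..} y"
  "sign_weight \<epsilon> (-1) y = exp \<epsilon> / (1 + exp \<epsilon>) - (exp \<epsilon> - 1) / (1 + exp \<epsilon>) * indicator {0..} y"
  by (auto simp: sign_weight_alt sign1_def add_divide_distrib diff_divide_distrib)

text \<open>By symmetry each output has probability 1/2 at \<theta>. Dividing the second value by
  the first gives the score, plus or minus \<open>opt_score\<close> of
  \<open>(exp \<epsilon> - 1) / (1 + exp \<epsilon>)\<close>.\<close>

lemma integral_sign_weight: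
  assumes "z \<in> {-1, 1}"
  shows "(\<integral>x. sign_weight \<epsilon> z (x - \<theta>) * normal_density \<theta> 1 x \<partial>lborel) = 1 / 2" (is "?D = _")
    and "(\<integral>x. (x - \<theta>) * (sign_weight \<epsilon> z (x - \<theta>) * normal_density \<theta> 1 x) \<partial>lborel)
      = of_int z * ((exp \<epsilon> - 1) / (1 + exp \<epsilon>)) * sqrt (2 / pi) / 2" (is "?N = _")
proof -
  let ?i = "\<lambda>y. indicator {0..} y :: real"
  define a where "a = (if z = 1 then 1 else exp \<epsilon>) / (1 + exp \<epsilon>)"
  define c where "c = (exp \<epsilon> - 1) / (1 + exp \<epsilon>)"
  define b where "b = of_int z * c"
  have w: "sign_weight \<epsilon> z y = a + b * ?i y" for y
    using assms by (auto simp: a_def b_def sign_weight_half_line[of \<epsilon>, folded c_def])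
  have ab: "a + b / 2 = 1 / 2"
  proof -
    define D where "D = 1 + exp \<epsilon>"
    have D: "D > 0" "exp \<epsilon> = D - 1" by (simp_all add: D_def add_pos_pos)
    show ?thesis
      using assms D(1) unfolding a_def b_def c_def D_def[symmetric] unfolding D(2) by (auto simp: field_simps)
  qed
  have "?D = (\<integral>y. sign_weight \<epsilon> z y * std_normal_density y \<partial>lborel)"
    by (subst lborel_integral_real_affine[where c=1 and t=\<theta>]) (simp_all add: normal_density_def)
  also have "\<dots> = (\<integral>y. a * std_normal_density y + ?i y * (b + 0 * y) * std_normal_density y \<partial>lborel)"
    by (simp add: w algebra_simps)
  also have "\<dots> = a * 1 + (b / 2 + 0 * sqrt (2 / pi) / 2)"
    by (intro has_bochner_integral_integral_eq has_bochner_integral_add has_bochner_integral_mult_right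
        has_bochner_integral_std_normal has_bochner_integral_half_std_normal)
  finally show "?D = 1 / 2" using ab by simp
  have "?N = (\<integral>y. y * (sign_weight \<epsilon> z y * std_normal_density y) \<partial>lborel)"
    by (subst lborel_integral_real_affine[where c=1 and t=\<theta>]) (simp_all add: normal_density_def)
  also have "\<dots> = (\<integral>y. a * (std_normal_density y * y) + ?i y * (0 + b * y) * std_normal_density y \<partial>lborel)"
    by (simp add: w algebra_simps)
  also have "\<dots> = a * 0 + (0 / 2 + b * sqrt (2 / pi) / 2)"
    by (intro has_bochner_integral_integral_eq has_bochner_integral_add has_bochner_integral_mult_right
        has_bochner_integral_std_normal_id has_bochner_integral_half_std_normal)
  finally show "?N = of_int z * ((exp \<epsilon> - 1) / (1 + exp \<epsilon>)) * sqrt (2 / pi) / 2" by (simp add: b_def c_def)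
qed

lemma fisher_information_sign_mechanism:
  assumes \<epsilon>: "0 < \<epsilon>"
  shows "fisher_information sign_space (sign_mechanism \<theta> \<epsilon>) \<theta>
    = (opt_score ((exp \<epsilon> - 1) / (1 + exp \<epsilon>)))\<^sup>2"
proof -
  define \<tau> where "\<tau> = (exp \<epsilon> - 1) / (1 + exp \<epsilon>)"
  let ?q = "\<lambda>z x. sign_weight \<epsilon> z (x - \<theta>) / sign_weight \<epsilon> z 0"
  let ?w = "\<lambda>z. sign_weight \<epsilon> z 0"
  \<comment> \<open>The density is relative to the output law at input \<theta>, with masses
    \<open>?w z\<close>; multiplying by these masses returns the probability 1/2.\<close>
  have pd: "privatized_density ?q \<theta> z = 1 / (2 * ?w z)" if z: "z \<in> {-1, 1}" for z
  proof -
    have "privatized_density ?q \<theta> z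
      = (\<integral>x. sign_weight \<epsilon> z (x - \<theta>) * normal_density \<theta> 1 x / ?w z \<partial>lborel)"
      by (simp add: privatized_density_def)
    then show ?thesis by (simp add: integral_sign_weight[OF z])
  qed
  have sc: "score ?q \<theta> z = of_int z * opt_score \<tau>" if z: "z \<in> {-1, 1}" for z
  proof -
    have "score ?q \<theta> z
      = (\<integral>x. 2 * ((x - \<theta>) * (sign_weight \<epsilon> z (x - \<theta>) * normal_density \<theta> 1 x)) \<partial>lborel)"
      unfolding score_def pd[OF z] using sign_weight_pos[of \<epsilon> z 0]
      by (intro Bochner_Integration.integral_cong) (auto simp: field_simps)
    then show ?thesis
      by (simp only: integral_mult_right_zero integral_sign_weight(2)[OF z, where \<epsilon>=\<epsilon> and \<theta>=\<theta>, folded \<tau>_def] opt_score_def) simp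
  qed
  have "fisher_information sign_space (sign_mechanism \<theta> \<epsilon>) \<theta>
    = (\<integral>z. (score ?q \<theta> z)\<^sup>2 * privatized_density ?q \<theta> z \<partial>sign_mechanism \<theta> \<epsilon> \<theta>)"
    by (rule fisher_information_eq[OF sign_mechanism_ldp kernel_density_sign_mechanism]) (use \<epsilon> in auto)
  also have "\<dots> = (\<Sum>z\<in>{-1, 1}. ?w z * ((score ?q \<theta> z)\<^sup>2 * privatized_density ?q \<theta> z))"
    unfolding sign_mechanism_eq
    by (subst lebesgue_integral_point_measure_finite) (auto simp: less_imp_le[OF sign_weight_pos])
  also have "\<dots> = (\<Sum>z\<in>{-1, 1::int}. (opt_score \<tau>)\<^sup>2 / 2)"
  proof (rule sum.cong[OF refl])
    fix z :: int assume z: "z \<in> {-1, 1}"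
    have "(of_int z :: real)\<^sup>2 = 1" using z by auto
    then show "?w z * ((score ?q \<theta> z)\<^sup>2 * privatized_density ?q \<theta> z) = (opt_score \<tau>)\<^sup>2 / 2"
      unfolding pd[OF z] sc[OF z] using sign_weight_pos[of \<epsilon> z 0] by (simp add: power_mult_distrib)
  qed
  also have "\<dots> = (opt_score \<tau>)\<^sup>2" by simp
  finally show ?thesis by (simp add: \<tau>_def)
qed

text \<open>The value 3 corresponds to \<open>\<tau> = 1 / 2\<close>, where the one-dimensional
  estimates stop. At 1.04 the exponential is about 2.83, so the crude bound 2.72 for e leaves
  room.\<close>

lemma exp_le_three:
  assumes "\<epsilon> \<le> (1.04 :: real)"
  shows "exp \<epsilon> \<le> 3"
proof -
  have "exp \<epsilon> \<le> exp (1 + 0.04 :: real)" using assms by simp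
  also have "\<dots> = exp 1 * exp (0.04 :: real)" by (rule exp_add)
  also have "\<dots> \<le> 2.72 * (1 + 0.04 + 0.04\<^sup>2)"
    using e_less_272 exp_bound[of "0.04"] by (intro mult_mono) auto
  also have "\<dots> \<le> 3" by (simp add: power2_eq_square)
  finally show ?thesis .
qed

theorem theorem1:
  fixes \<epsilon> :: real
  assumes "0 < \<epsilon>" and "\<epsilon> \<le> 1.04"
  shows "\<forall>\<theta>::real.
    sign_mechanism \<theta> \<epsilon> \<in> ldp_mechanisms \<epsilon> sign_space \<and>
    (\<forall>(Z :: 'z measure). \<forall>Q \<in> ldp_mechanisms \<epsilon> Z.
       fisher_information Z Q \<theta> \<le> fisher_information sign_space (sign_mechanism \<theta> \<epsilon>) \<theta>) \<and>
    fisher_information sign_space (sign_mechanism \<theta> \<epsilon>) \<theta>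
      = 2 / pi * ((exp \<epsilon> - 1)\<^sup>2 / (exp \<epsilon> + 1)\<^sup>2)"
proof
  fix \<theta> :: real
  define \<tau> where "\<tau> = (exp \<epsilon> - 1) / (1 + exp \<epsilon>)"
  have e: "1 < exp \<epsilon>" "exp \<epsilon> \<le> 3" using assms by (simp_all add: exp_le_three)
  have \<tau>: "0 < \<tau>" "\<tau> \<le> 1 / 2" "exp \<epsilon> = (1 + \<tau>) / (1 - \<tau>)"
  proof -
    define D where "D = 1 + exp \<epsilon>"
    have D: "2 < D" "D \<le> 4" "exp \<epsilon> = D - 1" using e by (simp_all add: D_def)
    have \<tau>D: "\<tau> = (D - 2) / D" by (simp add: \<tau>_def D_def)
    show "0 < \<tau>" "\<tau> \<le> 1 / 2" "exp \<epsilon> = (1 + \<tau>) / (1 - \<tau>)"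
      unfolding D(3) \<tau>D using D(1,2) by (simp_all add: field_simps)
  qed
  have sgn: "fisher_information sign_space (sign_mechanism \<theta> \<epsilon>) \<theta> = (opt_score \<tau>)\<^sup>2"
    unfolding \<tau>_def by (rule fisher_information_sign_mechanism[OF assms(1)])
  have "(opt_score \<tau>)\<^sup>2 = 2 / pi * ((exp \<epsilon> - 1)\<^sup>2 / (exp \<epsilon> + 1)\<^sup>2)"
    by (simp add: opt_score_def power_mult_distrib \<tau>_def power_divide add.commute)
  with sgn show "sign_mechanism \<theta> \<epsilon> \<in> ldp_mechanisms \<epsilon> sign_space \<and>
    (\<forall>(Z :: 'z measure). \<forall>Q \<in> ldp_mechanisms \<epsilon> Z.
       fisher_information Z Q \<theta> \<le> fisher_information sign_space (sign_mechanism \<theta> \<epsilon>) \<theta>) \<and>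
    fisher_information sign_space (sign_mechanism \<theta> \<epsilon>) \<theta>
      = 2 / pi * ((exp \<epsilon> - 1)\<^sup>2 / (exp \<epsilon> + 1)\<^sup>2)"
    using fisher_information_le[OF _ assms(1) \<tau>] sign_mechanism_ldp[of \<epsilon> \<theta>] assms(1)
    by (simp only:) auto
qed

end
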